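(* Let $S^n$ be the unit sphere in $\mathbb R^{n+1}$. For $i=1,\ldots,n$ let $p_i(t_1,\ldots,t_{n+1})$ be a nonzero real homogeneous harmonic polynomial of degree $m_i$ and let $u_i=p_i|_{S^n}$. Assume that $u_1,\ldots,u_n$ is a generic system of spherical harmonics, i.e. that $p_1,\ldots,p_n$ have finitely many common zeros on the complex affine hypersurface $\sum_{i=1}^{n+1}z_i^2=1$ in $\mathbb C^{n+1}$. Then $$\#Z(u_1,\ldots,u_n)\le 2\cdot m_1\cdot\ldots\cdot m_n,$$ where $Z(u_1,\ldots,u_n)=\{x\in S^n : u_1(x)=\ldots=u_n(x)=0\}$.
   Context: A polynomial $p$ on $\mathbb R^{n+1}$ is harmonic if $\sum_{i=1}^{n+1}\partial^2 p/\partial t_i^2=0$. A spherical harmonic of degree $m$ is the restriction to $S^n$ of a homogeneous harmonic polynomial of degree $m$. *)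

theory Defs
  imports "HOL-Analysis.Analysis" "HOL-Library.Poly_Mapping"
begin

text \<open>
  Polynomials with coefficients in \<open>'a\<close> and variables indexed by the finite type \<open>'v\<close> are finitely
  supported maps from exponent vectors to coefficients, so that the ring structure is the one of
  \<^theory>\<open>HOL-Library.Poly_Mapping\<close>. They are formal objects, which is what allows a real polynomial
  to be evaluated at complex points.
\<close>

type_synonym ('v, 'a) mvpoly = "('v \<Rightarrow>\<^sub>0 nat) \<Rightarrow>\<^sub>0 'a"

definition mvpoly_eval :: "('v::finite, 'a::comm_semiring_1) mvpoly \<Rightarrow> 'a ^ 'v \<Rightarrow> 'a" where
  "mvpoly_eval p x =
     (\<Sum>e\<in>Poly_Mapping.keys p. Poly_Mapping.lookup p e * (\<Prod>i\<in>UNIV. (x $ i) ^ Poly_Mapping.lookup e i))"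

definition complexify :: "('v, real) mvpoly \<Rightarrow> ('v, complex) mvpoly" where
  "complexify p = Poly_Mapping.map complex_of_real p"

text \<open>
  When variable \<open>i\<close> does not occur in the monomial \<open>e\<close>, the truncated exponent \<open>e - single i 1\<close> is
  harmless because its coefficient is then 0.
\<close>

definition mvpoly_pderiv :: "'v \<Rightarrow> ('v, 'a::comm_semiring_1) mvpoly \<Rightarrow> ('v, 'a) mvpoly" where
  "mvpoly_pderiv i p =
     (\<Sum>e\<in>Poly_Mapping.keys p.
        Poly_Mapping.single (e - Poly_Mapping.single i 1)
          (of_nat (Poly_Mapping.lookup e i) * Poly_Mapping.lookup p e))"

text \<open>As usual, the zero polynomial is homogeneous of every degree.\<close>

definition homogeneous :: "nat \<Rightarrow> ('v::finite, 'a::zero) mvpoly \<Rightarrow> bool" where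
  "homogeneous d p \<longleftrightarrow>
     (\<forall>e\<in>Poly_Mapping.keys p. (\<Sum>i\<in>UNIV. Poly_Mapping.lookup e i) = d)"

definition harmonic :: "('v::finite, real) mvpoly \<Rightarrow> bool" where
  "harmonic p \<longleftrightarrow> (\<Sum>i\<in>UNIV. mvpoly_pderiv i (mvpoly_pderiv i p)) = 0"

definition sphere_restriction :: "('v::finite, real) mvpoly \<Rightarrow> real ^ 'v \<Rightarrow> real" where
  "sphere_restriction p = restrict (mvpoly_eval p) (sphere 0 1)"

definition complex_sphere :: "(complex ^ 'v::finite) set" where
  "complex_sphere = {z. (\<Sum>i\<in>UNIV. (z $ i)\<^sup>2) = 1}"

definition generic_system :: "'i set \<Rightarrow> ('i \<Rightarrow> ('v::finite, real) mvpoly) \<Rightarrow> bool" where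
  "generic_system I p \<longleftrightarrow>
     finite {z \<in> complex_sphere. \<forall>i\<in>I. mvpoly_eval (complexify (p i)) z = 0}"

definition common_zeros :: "'i set \<Rightarrow> ('i \<Rightarrow> real ^ 'v::finite \<Rightarrow> real) \<Rightarrow> (real ^ 'v) set" where
  "common_zeros I u = {x \<in> sphere 0 1. \<forall>i\<in>I. u i x = 0}"

end

theory Submission
  imports Defs "HOL-Computational_Algebra.Fundamental_Theorem_Algebra"
begin

text \<open>
  Together with \<open>\<Sum> x\<^sub>j\<^sup>2 - 1\<close> the \<open>p\<^sub>i\<close> form a square system \<open>f\<close> of \<open>N = n + 1\<close> equations, and the
  claim is an affine Bezout inequality for a system with a finite zero set \<open>Z\<close>. Choose polynomials
  \<open>h\<^sub>z\<close> with \<open>h\<^sub>z w = \<delta>\<^sub>z\<^sub>w\<close> on \<open>Z\<close>. Since the zeros are isolated, the \<open>f\<^sub>i\<close> are analytically independent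
  at each of them, and therefore the \<open>h\<^sub>z\<close> are linearly independent over \<open>\<complex>[f]\<close>. Comparing the number of
  products \<open>f\<^sup>a h\<^sub>z\<close> of degree at most \<open>M\<close> with the dimension of the space of all polynomials
  of degree at most \<open>M\<close> gives \<open>card Z \<le> \<Prod> deg f\<^sub>i\<close>. Isolatedness enters through the Nullstellensatz,
  in the form that the ideal of \<open>f\<close> contains a nonzero polynomial in each single variable.
\<close>

section \<open>Polynomials as finitely supported maps\<close>

abbreviation "lookup \<equiv> Poly_Mapping.lookup"
abbreviation "keys \<equiv> Poly_Mapping.keys"
abbreviation "single \<equiv> Poly_Mapping.single"

definition mdeg :: "('v::finite \<Rightarrow>\<^sub>0 nat) \<Rightarrow> nat" where
  "mdeg e = (\<Sum>i\<in>UNIV. lookup e i)"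

definition mpow :: "('v::finite \<Rightarrow> 'b::comm_monoid_mult) \<Rightarrow> ('v \<Rightarrow>\<^sub>0 nat) \<Rightarrow> 'b" where
  "mpow x e = (\<Prod>i\<in>UNIV. x i ^ lookup e i)"

definition Const :: "'a \<Rightarrow> ('v, 'a::zero) mvpoly" where
  "Const c = single 0 c"

definition Var :: "'v \<Rightarrow> ('v, 'a::zero_neq_one) mvpoly" where
  "Var i = single (single i 1) 1"

lemma mdeg_add: "mdeg (a + b) = mdeg a + mdeg b"
  by (simp add: mdeg_def lookup_add sum.distrib)

lemma mdeg_zero [simp]: "mdeg 0 = 0"
  by (simp add: mdeg_def)

lemma mdeg_single [simp]: "mdeg (single i k) = k"
  by (simp add: mdeg_def lookup_single when_def)

lemma lookup_le_mdeg: "lookup e i \<le> mdeg e"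
  unfolding mdeg_def by (rule member_le_sum) auto

lemma mpow_zero [simp]: "mpow x 0 = 1"
  by (simp add: mpow_def)

lemma mpow_add: "mpow x (a + b) = mpow x a * mpow x b"
  by (simp add: mpow_def lookup_add power_add prod.distrib)

lemma mpow_single [simp]: "mpow x (single i k) = x i ^ k"
proof -
  have "mpow x (single i k) = (\<Prod>j\<in>UNIV. if j = i then x i ^ k else 1)"
    unfolding mpow_def by (rule prod.cong) (auto simp: lookup_single when_def)
  then show ?thesis by simp
qed

lemma Const_zero [simp]: "Const 0 = 0"
  by (simp add: Const_def)

lemma Const_one [simp]: "Const 1 = 1"
  by (simp add: Const_def)

lemma Const_add: "Const (a + b) = Const a + Const (b::'a::monoid_add)"
  by (simp add: Const_def single_add)

lemma Const_uminus: "Const (- a) = - Const (a::'a::ab_group_add)"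
  by (simp add: Const_def single_uminus)

lemma Const_mult: "Const (a * b) = Const a * Const (b::'a::semiring_0)"
  by (simp add: Const_def mult_single)

lemma Const_mult_single: "Const a * single e b = single e (a * b :: 'a::semiring_0)"
  by (simp add: Const_def mult_single)

lemma lookup_Const_mult: "lookup (Const c * p) e = c * lookup p (e :: 'v \<Rightarrow>\<^sub>0 nat)"
  for c :: "'a::comm_semiring_1"
  unfolding Const_def mult_map_scale_conv_mult[symmetric]
  by (simp add: Poly_Mapping.map.rep_eq when_def)

lemma sum_single_lookup: "(\<Sum>i\<in>UNIV. single i (lookup e i)) = e" for e :: "'v::finite \<Rightarrow>\<^sub>0 nat"
  by (rule poly_mapping_eqI) (simp add: lookup_sum lookup_single when_def)

lemma prod_single_one: "(\<Prod>i\<in>A. single (g i) (1::'a::comm_semiring_1)) = single (\<Sum>i\<in>A. g i) 1"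
  by (induction A rule: infinite_finite_induct) (auto simp: mult_single)

lemma mpow_Var: "mpow Var e = single e (1::'a::comm_semiring_1)"
  for e :: "'v::finite \<Rightarrow>\<^sub>0 nat"
proof -
  have "(Var i :: ('v, 'a) mvpoly) ^ k = single (single i k) 1" for i :: 'v and k
    by (induction k) (auto simp: Var_def mult_single single_add[symmetric])
  then show ?thesis
    by (simp add: mpow_def prod_single_one sum_single_lookup)
qed

lemma single_eq_Const_mpow: "single e c = Const c * mpow Var e" for c :: "'a::comm_semiring_1"
  by (simp add: mpow_Var Const_mult_single)

lemma sum_single_keys: "p = (\<Sum>e\<in>keys p. single e (lookup p e))"
  for p :: "'k \<Rightarrow>\<^sub>0 'a::comm_monoid_add"
  by (rule poly_mapping_eqI)
    (simp add: lookup_sum lookup_single when_def in_keys_iff)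

text \<open>Constants and variables generate the polynomial ring. This reduces congruences modulo an
  ideal and identities between ring homomorphisms to a check on generators.\<close>

lemma mvpoly_induct [case_names Const Var add mult]:
  fixes p :: "('v::finite, 'a::comm_semiring_1) mvpoly"
  assumes "\<And>c. P (Const c)" "\<And>i. P (Var i)"
    and add: "\<And>p q. P p \<Longrightarrow> P q \<Longrightarrow> P (p + q)" and mult: "\<And>p q. P p \<Longrightarrow> P q \<Longrightarrow> P (p * q)"
  shows "P p"
proof -
  have one: "P 1" using assms(1)[of 1] by simp
  have zero: "P 0" using assms(1)[of 0] by simp
  have pw: "P (Var i ^ k)" for i k
    by (induction k) (auto intro: one assms)
  have "P (\<Prod>i\<in>A. Var i ^ k i)" for A :: "'v set" and k
    by (induction A rule: infinite_finite_induct) (auto intro: one pw assms)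
  then have "P (single e c)" for e c
    unfolding single_eq_Const_mpow mpow_def by (intro mult assms(1))
  then have "P (\<Sum>e\<in>A. single e (c e))" for A c
    by (induction A rule: infinite_finite_induct) (auto intro: zero add)
  then show ?thesis
    by (subst sum_single_keys)
qed

section \<open>Evaluation and substitution homomorphisms\<close>

locale coeff_hom =
  fixes \<kappa> :: "'a::comm_semiring_1 \<Rightarrow> 'b::comm_semiring_1"
  assumes hom_zero: "\<kappa> 0 = 0" and hom_one: "\<kappa> 1 = 1"
    and hom_add: "\<kappa> (a + b) = \<kappa> a + \<kappa> b" and hom_mult: "\<kappa> (a * b) = \<kappa> a * \<kappa> b"
begin

text \<open>With \<kappa> the identity this is evaluation at a point; with \<kappa> =
  \<open>Const\<close> it is substitution of polynomials for the variables.\<close>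

definition insertion :: "('v::finite \<Rightarrow> 'b) \<Rightarrow> ('v, 'a) mvpoly \<Rightarrow> 'b" where
  "insertion x p = (\<Sum>e\<in>keys p. \<kappa> (lookup p e) * mpow x e)"

lemma insertion_superset:
  assumes "finite A" "keys p \<subseteq> A"
  shows "insertion x p = (\<Sum>e\<in>A. \<kappa> (lookup p e) * mpow x e)"
  unfolding insertion_def using assms
  by (intro sum.mono_neutral_left) (auto simp: in_keys_iff hom_zero)

lemma insertion_zero [simp]: "insertion x 0 = 0"
  by (simp add: insertion_def)

lemma insertion_single: "insertion x (single e c) = \<kappa> c * mpow x e"
  by (subst insertion_superset[of "{e}"]) (auto simp: hom_zero)

lemma insertion_Const [simp]: "insertion x (Const c) = \<kappa> c"
  by (simp add: Const_def insertion_single)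

lemma insertion_Var [simp]: "insertion x (Var i) = x i"
  by (simp add: Var_def insertion_single hom_one)

lemma insertion_one [simp]: "insertion x 1 = 1"
  using insertion_Const[of x 1] by (simp add: hom_one)

lemma insertion_add: "insertion x (p + q) = insertion x p + insertion x q"
  by (subst (1 2 3) insertion_superset[of "keys p \<union> keys q"])
    (auto simp: keys_add lookup_add hom_add distrib_right sum.distrib)

lemma insertion_sum: "insertion x (sum f A) = (\<Sum>a\<in>A. insertion x (f a))"
  by (induction A rule: infinite_finite_induct) (auto simp: insertion_add)

lemma insertion_mult: "insertion x (p * q) = insertion x p * insertion x q"
proof -
  have "insertion x (p * q) = insertion x ((\<Sum>e\<in>keys p. single e (lookup p e)) * (\<Sum>e\<in>keys q. single e (lookup q e)))"
    by (simp flip: sum_single_keys)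
  also have "\<dots> = (\<Sum>d\<in>keys p. \<Sum>e\<in>keys q. insertion x (single d (lookup p d)) * insertion x (single e (lookup q e)))"
    by (simp add: sum_product insertion_sum mult_single insertion_single mpow_add hom_mult mult_ac)
  also have "\<dots> = insertion x (\<Sum>e\<in>keys p. single e (lookup p e)) * insertion x (\<Sum>e\<in>keys q. single e (lookup q e))"
    by (simp add: sum_product insertion_sum)
  finally show ?thesis by (simp flip: sum_single_keys)
qed

lemma insertion_power: "insertion x (p ^ k) = insertion x p ^ k"
  by (induction k) (auto simp: insertion_mult)

lemma insertion_prod: "insertion x (prod f A) = (\<Prod>a\<in>A. insertion x (f a))"
  by (induction A rule: infinite_finite_induct) (auto simp: insertion_mult)

lemma insertion_mpow: "insertion x (mpow f e) = mpow (\<lambda>i. insertion x (f i)) e"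
  by (simp add: mpow_def insertion_prod insertion_power)

end

lemma coeff_hom_id: "coeff_hom (\<lambda>c::'a::comm_semiring_1. c)"
  by (rule coeff_hom.intro) simp_all

lemma coeff_hom_Const: "coeff_hom (Const :: 'a::comm_semiring_1 \<Rightarrow> ('v, 'a) mvpoly)"
  by (rule coeff_hom.intro) (simp_all add: Const_add Const_mult)

interpretation eval: coeff_hom "\<lambda>c::'a::comm_semiring_1. c"
  by (rule coeff_hom_id)

interpretation subst: coeff_hom "Const :: 'a::comm_semiring_1 \<Rightarrow> ('v, 'a) mvpoly"
  by (rule coeff_hom_Const)

lemma mvpoly_eval_insertion: "mvpoly_eval p z = eval.insertion (($) z) p"
  by (simp add: mvpoly_eval_def eval.insertion_def mpow_def)

lemma mvpoly_eval_hom [simp]: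
  "mvpoly_eval (Const c) z = c" "mvpoly_eval (Var i) z = z $ i"
  "mvpoly_eval 0 z = 0" "mvpoly_eval 1 z = 1"
  "mvpoly_eval (p + q) z = mvpoly_eval p z + mvpoly_eval q z"
  "mvpoly_eval (p * q) z = mvpoly_eval p z * mvpoly_eval q z"
  "mvpoly_eval (p ^ k) z = mvpoly_eval p z ^ k"
  "mvpoly_eval (sum f A) z = (\<Sum>a\<in>A. mvpoly_eval (f a) z)"
  "mvpoly_eval (prod f A) z = (\<Prod>a\<in>A. mvpoly_eval (f a) z)"
  unfolding mvpoly_eval_insertion
  by (rule eval.insertion_Const eval.insertion_Var eval.insertion_zero eval.insertion_one
      eval.insertion_add eval.insertion_mult eval.insertion_power eval.insertion_sum
      eval.insertion_prod)+

lemma mvpoly_eval_diff [simp]: "mvpoly_eval (p - q) z = mvpoly_eval p z - mvpoly_eval q z"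
  for z :: "'a::comm_ring_1 ^ 'v::finite"
  using mvpoly_eval_hom(5)[of "p - q" q z] by (simp add: algebra_simps)

lemma mvpoly_eval_uminus [simp]: "mvpoly_eval (- p) z = - mvpoly_eval p z"
  for z :: "'a::comm_ring_1 ^ 'v::finite"
  using mvpoly_eval_diff[of 0 p z] by simp

lemma lookup_zero_eq_eval: "lookup p 0 = mvpoly_eval p 0"
  for p :: "('v::finite, 'a::comm_semiring_1) mvpoly"
proof -
  have "mvpoly_eval p 0 = (\<Sum>e\<in>keys p. if e = 0 then lookup p 0 else 0)"
    unfolding mvpoly_eval_def
  proof (rule sum.cong)
    fix e :: "'v \<Rightarrow>\<^sub>0 nat"
    show "lookup p e * (\<Prod>i\<in>UNIV. (0 $ i) ^ lookup e i) = (if e = 0 then lookup p 0 else 0)"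
    proof (cases "e = 0")
      case False
      then obtain i where "lookup e i \<noteq> 0"
        by (auto simp: poly_mapping_eq_iff fun_eq_iff)
      then have "(0 $ i :: 'a) ^ lookup e i = 0"
        by (simp add: zero_power)
      then have "(\<Prod>i\<in>UNIV. (0 $ i :: 'a) ^ lookup e i) = 0"
        by (rule prod_zero[OF finite_class.finite_UNIV bexI[OF _ UNIV_I]])
      with False show ?thesis by simp
    qed auto
  qed auto
  then show ?thesis by (simp add: in_keys_iff)
qed

text \<open>The Taylor shift that moves the point \<open>z\<close> to the origin, so that the order
  of vanishing at \<open>z\<close> can be read off from the monomials.\<close>

definition translate :: "('a::comm_semiring_1) ^ 'v::finite \<Rightarrow> ('v, 'a) mvpoly \<Rightarrow> ('v, 'a) mvpoly" where
  "translate z = subst.insertion (\<lambda>i. Var i + Const (z $ i))"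

lemma translate_hom:
  "translate z (Const c) = Const c" "translate z (Var i) = Var i + Const (z $ i)"
  "translate z 0 = 0" "translate z 1 = 1"
  "translate z (p + q) = translate z p + translate z q"
  "translate z (p * q) = translate z p * translate z q"
  "translate z (p ^ k) = translate z p ^ k"
  "translate z (sum f A) = (\<Sum>a\<in>A. translate z (f a))"
  "translate z (mpow g e) = mpow (\<lambda>i. translate z (g i)) e"
  by (simp_all add: translate_def subst.insertion_add subst.insertion_mult
      subst.insertion_power subst.insertion_sum subst.insertion_mpow)

lemma translate_diff: "translate z (p - q) = translate z p - translate z q"
  for z :: "'a::comm_ring_1 ^ 'v::finite"
  using translate_hom(5)[of z "p - q" q] by (simp add: algebra_simps)

lemma eval_translate: "mvpoly_eval (translate z p) w = mvpoly_eval p (z + w)"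
  by (induction p rule: mvpoly_induct) (auto simp: translate_hom add.commute)

section \<open>Filtrations by degree and by order of vanishing at the origin\<close>

definition lowdeg :: "nat \<Rightarrow> ('v::finite, 'a::zero) mvpoly set" where
  "lowdeg d = {p. \<forall>e\<in>keys p. mdeg e \<le> d}"

text \<open>Over a field this is the \<open>d\<close>-th power of the maximal ideal at the
  origin.\<close>

definition hideg :: "nat \<Rightarrow> ('v::finite, 'a::zero) mvpoly set" where
  "hideg d = {p. \<forall>e\<in>keys p. d \<le> mdeg e}"

lemma keys_sum_subset: "keys (sum f A) \<subseteq> (\<Union>x\<in>A. keys (f x))"
  for f :: "'b \<Rightarrow> 'k \<Rightarrow>\<^sub>0 'a::comm_monoid_add"
proof
  fix e assume "e \<in> keys (sum f A)"
  then have "(\<Sum>x\<in>A. lookup (f x) e) \<noteq> 0"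
    by (simp add: in_keys_iff lookup_sum)
  then obtain x where "x \<in> A" "lookup (f x) e \<noteq> 0"
    by (meson sum.not_neutral_contains_not_neutral)
  then show "e \<in> (\<Union>x\<in>A. keys (f x))"
    by (auto simp: in_keys_iff)
qed

lemma lowdeg_mult: "p \<in> lowdeg c \<Longrightarrow> q \<in> lowdeg d \<Longrightarrow> p * q \<in> lowdeg (c + d)"
  for p q :: "('v::finite, 'a::comm_semiring_1) mvpoly"
  using keys_mult[of p q] by (auto simp: lowdeg_def mdeg_add intro!: add_mono dest!: subsetD)

lemma lowdeg_one [simp]: "1 \<in> lowdeg d"
  by (auto simp: lowdeg_def)

lemma lowdeg_mono: "p \<in> lowdeg c \<Longrightarrow> c \<le> d \<Longrightarrow> p \<in> lowdeg d"
  unfolding lowdeg_def by (auto intro: le_trans)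

lemma lowdeg_power: "p \<in> lowdeg d \<Longrightarrow> p ^ k \<in> lowdeg (k * d)"
  for p :: "('v::finite, 'a::comm_semiring_1) mvpoly"
  by (induction k) (auto intro: lowdeg_mult)

lemma lowdeg_prod:
  fixes f :: "'b \<Rightarrow> ('v::finite, 'a::comm_semiring_1) mvpoly"
  shows "(\<And>i. i \<in> A \<Longrightarrow> f i \<in> lowdeg (d i)) \<Longrightarrow> prod f A \<in> lowdeg (sum d A)"
  by (induction A rule: infinite_finite_induct) (auto intro: lowdeg_mult)

lemma lowdeg_mpow:
  fixes f :: "'v::finite \<Rightarrow> ('v, 'a::comm_semiring_1) mvpoly"
  assumes "\<And>i. f i \<in> lowdeg (d i)"
  shows "mpow f e \<in> lowdeg (\<Sum>i\<in>UNIV. lookup e i * d i)"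
  unfolding mpow_def by (intro lowdeg_prod lowdeg_power assms)

lemma lowdeg_exists: "\<exists>d. p \<in> lowdeg d"
proof
  show "p \<in> lowdeg (\<Sum>e\<in>keys p. mdeg e)"
    by (auto simp: lowdeg_def intro!: member_le_sum)
qed

lemma hideg_mult: "p \<in> hideg c \<Longrightarrow> q \<in> hideg d \<Longrightarrow> p * q \<in> hideg (c + d)"
  for p q :: "('v::finite, 'a::comm_semiring_1) mvpoly"
  using keys_mult[of p q] by (auto simp: hideg_def mdeg_add intro!: add_mono dest!: subsetD)

lemma hideg_0 [simp]: "p \<in> hideg 0"
  by (auto simp: hideg_def)

lemma hideg_mono: "p \<in> hideg c \<Longrightarrow> d \<le> c \<Longrightarrow> p \<in> hideg d"
  unfolding hideg_def by (auto intro: le_trans)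

lemma hideg_zero [simp]: "0 \<in> hideg d"
  by (auto simp: hideg_def)

lemma hideg_power: "p \<in> hideg d \<Longrightarrow> p ^ k \<in> hideg (k * d)"
  for p :: "('v::finite, 'a::comm_semiring_1) mvpoly"
  by (induction k) (auto intro: hideg_mult)

lemma hideg_prod:
  fixes f :: "'b \<Rightarrow> ('v::finite, 'a::comm_semiring_1) mvpoly"
  shows "(\<And>i. i \<in> A \<Longrightarrow> f i \<in> hideg (d i)) \<Longrightarrow> prod f A \<in> hideg (sum d A)"
  by (induction A rule: infinite_finite_induct) (auto intro: hideg_mult)

lemma hideg_mpow:
  fixes f :: "'v::finite \<Rightarrow> ('v, 'a::comm_semiring_1) mvpoly"
  assumes "\<And>i. f i \<in> hideg 1"
  shows "mpow f e \<in> hideg (mdeg e)"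
proof -
  have "f i ^ k \<in> hideg k" for i k using hideg_power[OF assms[of i], of k] by simp
  then show ?thesis unfolding mpow_def mdeg_def by (intro hideg_prod)
qed

lemma hideg_1_iff: "p \<in> hideg 1 \<longleftrightarrow> mvpoly_eval p 0 = 0"
  for p :: "('v::finite, 'a::comm_semiring_1) mvpoly"
proof -
  have *: "1 \<le> mdeg e \<longleftrightarrow> e \<noteq> 0" for e :: "'v \<Rightarrow>\<^sub>0 nat"
    by (auto simp: mdeg_def Suc_le_eq sum_nonneg_eq_0_iff poly_mapping_eq_iff fun_eq_iff simp flip: neq0_conv)
  have "p \<in> hideg 1 \<longleftrightarrow> 0 \<notin> keys p"
    unfolding hideg_def * by blast
  then show ?thesis by (simp add: in_keys_iff lookup_zero_eq_eval)
qed

section \<open>Linear systems and ideals\<close>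

text \<open>Gaussian elimination: an equation with a nonzero coefficient at \<open>x0\<close> is
  solved for the unknown \<open>x0\<close> and substituted into the others. All dimension counts
  below are applications of this lemma, with one equation for each monomial or each spanning
  element.\<close>

lemma underdetermined_system:
  fixes A :: "'y \<Rightarrow> 'x \<Rightarrow> 'a::field"
  assumes "finite Y" "finite X" "card Y < card X"
  shows "\<exists>l. (\<exists>x\<in>X. l x \<noteq> 0) \<and> (\<forall>y\<in>Y. (\<Sum>x\<in>X. A y x * l x) = 0)"
  using assms
proof (induction Y arbitrary: X A rule: finite_induct)
  case empty
  then have "X \<noteq> {}" by auto
  then show ?case by (intro exI[of _ "\<lambda>_. 1"]) auto
next
  case (insert y Y)
  show ?case
  proof (cases "\<forall>x\<in>X. A y x = 0")
    case True
    with insert.IH[of X A] insert.prems insert.hyps show ?thesis by auto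
  next
    case False
    then obtain x0 where x0: "x0 \<in> X" "A y x0 \<noteq> 0" by auto
    define X' where "X' = X - {x0}"
    have X': "finite X'" "x0 \<notin> X'" "X = insert x0 X'" "card Y < card X'"
      using x0 insert.prems insert.hyps by (auto simp: X'_def)
    obtain l where l: "\<exists>x\<in>X'. l x \<noteq> 0"
      "\<And>y'. y' \<in> Y \<Longrightarrow> (\<Sum>x\<in>X'. (A y' x - A y' x0 * A y x / A y x0) * l x) = 0"
      using insert.IH[OF X'(1) X'(4), of "\<lambda>y' x. A y' x - A y' x0 * A y x / A y x0"] by auto
    define s where "s = (\<Sum>x\<in>X'. A y x * l x)"
    define l' where "l' = l(x0 := - s / A y x0)"
    have sum_l': "(\<Sum>x\<in>X. A y' x * l' x) = (\<Sum>x\<in>X'. A y' x * l x) - A y' x0 * s / A y x0" for y'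
    proof -
      have "(\<Sum>x\<in>X'. A y' x * l' x) = (\<Sum>x\<in>X'. A y' x * l x)"
        using X'(2) by (intro sum.cong) (auto simp: l'_def)
      then show ?thesis
        using X'(1,2) by (simp add: X'(3)) (simp add: l'_def)
    qed
    have "(\<Sum>x\<in>X. A y x * l' x) = 0"
      using x0 by (simp add: sum_l' s_def)
    moreover have "(\<Sum>x\<in>X. A y' x * l' x) = 0" if "y' \<in> Y" for y'
    proof -
      have "(\<Sum>x\<in>X'. (A y' x - A y' x0 * A y x / A y x0) * l x)
          = (\<Sum>x\<in>X'. A y' x * l x) - A y' x0 * s / A y x0"
        by (simp add: s_def left_diff_distrib sum_subtractf sum_distrib_left sum_divide_distrib mult.assoc)
      with l(2)[OF that] show ?thesis by (simp add: sum_l')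
    qed
    moreover have "\<exists>x\<in>X. l' x \<noteq> 0"
      using l(1) X' by (auto simp: l'_def)
    ultimately show ?thesis by blast
  qed
qed

lemma bij_lookup: "bij_betw lookup (UNIV :: ('v::finite \<Rightarrow>\<^sub>0 nat) set) UNIV"
proof (rule bij_betwI[of _ _ _ Abs_poly_mapping])
  fix g :: "'v \<Rightarrow> nat"
  show "lookup (Abs_poly_mapping g) = g"
    by (simp add: Abs_poly_mapping_inverse)
qed (auto simp: lookup_inverse)

lemma exponent_box:
  fixes A :: "'v::finite \<Rightarrow> nat set"
  assumes "\<And>i. finite (A i)"
  shows "finite {e. \<forall>i. lookup e i \<in> A i}" "card {e. \<forall>i. lookup e i \<in> A i} = (\<Prod>i\<in>UNIV. card (A i))"
proof -
  have "bij_betw lookup {e. \<forall>i. lookup e i \<in> A i} (PiE UNIV A)"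
    unfolding bij_betw_def
  proof
    show "inj_on lookup {e. \<forall>i. lookup e i \<in> A i}"
      using bij_lookup by (auto simp: bij_betw_def intro: inj_on_subset)
    show "lookup ` {e. \<forall>i. lookup e i \<in> A i} = PiE UNIV A"
    proof (intro equalityI subsetI)
      fix g assume "g \<in> PiE UNIV A"
      then show "g \<in> lookup ` {e. \<forall>i. lookup e i \<in> A i}"
        by (intro image_eqI[of _ _ "Abs_poly_mapping g"])
          (auto simp: Abs_poly_mapping_inverse PiE_iff)
    qed auto
  qed
  then show "finite {e. \<forall>i. lookup e i \<in> A i}" "card {e. \<forall>i. lookup e i \<in> A i} = (\<Prod>i\<in>UNIV. card (A i))"
    using assms by (auto simp: bij_betw_finite bij_betw_same_card card_PiE finite_PiE)
qed

lemma finite_mdeg_le: "finite {e :: 'v::finite \<Rightarrow>\<^sub>0 nat. mdeg e \<le> d}"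
  by (rule finite_subset[OF _ exponent_box(1)[of "\<lambda>_. {..d}"]])
    (auto intro: order_trans[OF lookup_le_mdeg])

lemma finite_mdeg_less: "finite {e :: 'v::finite \<Rightarrow>\<^sub>0 nat. mdeg e < d}"
  by (rule finite_subset[OF _ finite_mdeg_le[of d]]) auto

lemma card_mdeg_le: "card {e :: 'v::finite \<Rightarrow>\<^sub>0 nat. mdeg e \<le> d} \<le> (d + 1) ^ CARD('v)"
proof -
  have "card {e :: 'v \<Rightarrow>\<^sub>0 nat. mdeg e \<le> d} \<le> card {e :: 'v \<Rightarrow>\<^sub>0 nat. \<forall>i. lookup e i \<in> {..d}}"
    by (intro card_mono exponent_box) (auto intro: order_trans[OF lookup_le_mdeg])
  then show ?thesis by (subst (asm) exponent_box) auto
qed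

section \<open>Ideals in commutative rings\<close>

definition is_ideal :: "'a::comm_ring_1 set \<Rightarrow> bool" where
  "is_ideal J \<longleftrightarrow> 0 \<in> J \<and> (\<forall>a\<in>J. \<forall>b\<in>J. a + b \<in> J) \<and> (\<forall>a\<in>J. \<forall>r. r * a \<in> J)"

definition adjoin :: "'a::comm_ring_1 set \<Rightarrow> 'a \<Rightarrow> 'a set" where
  "adjoin J x = {a + r * x | a r. a \<in> J}"

definition idl :: "('i \<Rightarrow> 'a::comm_ring_1) \<Rightarrow> 'a set" where
  "idl f = range (\<lambda>r. \<Sum>i\<in>UNIV. r i * f i)"

context
  fixes J :: "'a::comm_ring_1 set"
  assumes J: "is_ideal J"
begin

lemma ideal_0: "0 \<in> J"
  and ideal_add: "a \<in> J \<Longrightarrow> b \<in> J \<Longrightarrow> a + b \<in> J"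
  and ideal_mult: "a \<in> J \<Longrightarrow> r * a \<in> J"
  using J by (auto simp: is_ideal_def)

lemma ideal_uminus: "a \<in> J \<Longrightarrow> - a \<in> J"
  using ideal_mult[of a "-1"] by simp

lemma ideal_diff: "a \<in> J \<Longrightarrow> b \<in> J \<Longrightarrow> a - b \<in> J"
  using ideal_add[of a "- b"] ideal_uminus[of b] by simp

lemma ideal_sum: "(\<And>x. x \<in> A \<Longrightarrow> g x \<in> J) \<Longrightarrow> sum g A \<in> J"
  by (induction A rule: infinite_finite_induct) (auto intro: ideal_0 ideal_add)

lemma ideal_adjoin: "is_ideal (adjoin J x)"
  unfolding is_ideal_def
proof (intro conjI ballI allI)
  show "0 \<in> adjoin J x"
    using ideal_0 by (auto simp: adjoin_def intro!: exI[of _ 0])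
next
  fix a b assume "a \<in> adjoin J x" "b \<in> adjoin J x"
  then obtain a' b' r s where "a = a' + r * x" "b = b' + s * x" "a' \<in> J" "b' \<in> J"
    by (auto simp: adjoin_def)
  then have "a + b = (a' + b') + (r + s) * x" "a' + b' \<in> J"
    by (auto simp: algebra_simps ideal_add)
  then show "a + b \<in> adjoin J x" unfolding adjoin_def by blast
next
  fix a r assume "a \<in> adjoin J x"
  then obtain a' s where "a = a' + s * x" "a' \<in> J"
    by (auto simp: adjoin_def)
  then have "r * a = r * a' + (r * s) * x" "r * a' \<in> J"
    by (simp_all add: ideal_mult distrib_left mult.assoc)
  then show "r * a \<in> adjoin J x" unfolding adjoin_def by blast
qed

lemma subset_adjoin: "J \<subseteq> adjoin J x"
  by (force simp: adjoin_def intro: exI[of _ 0])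

lemma in_adjoin: "x \<in> adjoin J x"
  using ideal_0 by (force simp: adjoin_def intro: exI[of _ 1])

lemma one_in_adjoinE:
  assumes "1 \<in> adjoin J x"
  obtains u where "u * x - 1 \<in> J"
proof -
  obtain a u where "1 = a + u * x" "a \<in> J" using assms by (auto simp: adjoin_def)
  then have "u * x - 1 = - a" by (simp add: algebra_simps)
  with \<open>a \<in> J\<close> show ?thesis by (intro that[of u]) (simp add: ideal_uminus)
qed

end

lemma is_ideal_idl: "is_ideal (idl (f :: 'i::finite \<Rightarrow> 'a::comm_ring_1))"
  unfolding is_ideal_def
proof (intro conjI ballI allI)
  show "0 \<in> idl f" unfolding idl_def by (auto intro!: image_eqI[of _ _ "\<lambda>_. 0"])
next
  fix a b assume "a \<in> idl f" "b \<in> idl f"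
  then obtain r s where "a = (\<Sum>i\<in>UNIV. r i * f i)" "b = (\<Sum>i\<in>UNIV. s i * f i)"
    by (auto simp: idl_def)
  then have "a + b = (\<Sum>i\<in>UNIV. (r i + s i) * f i)"
    by (simp add: algebra_simps sum.distrib)
  then show "a + b \<in> idl f"
    unfolding idl_def by (intro image_eqI[where x = "\<lambda>i. r i + s i"]) auto
next
  fix a s assume "a \<in> idl f"
  then obtain r where "a = (\<Sum>i\<in>UNIV. r i * f i)" by (auto simp: idl_def)
  then have "s * a = (\<Sum>i\<in>UNIV. (s * r i) * f i)"
    by (simp add: sum_distrib_left mult.assoc)
  then show "s * a \<in> idl f"
    unfolding idl_def by (intro image_eqI[where x = "\<lambda>i. s * r i"]) auto
qed

lemma generator_in_idl: "f i \<in> idl (f :: 'i::finite \<Rightarrow> 'a::comm_ring_1)"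
proof -
  have "(\<Sum>j\<in>UNIV. (if j = i then 1 else 0) * f j) = (\<Sum>j\<in>UNIV. if j = i then f j else 0)"
    by (rule sum.cong) auto
  then show ?thesis
    unfolding idl_def by (intro image_eqI[of _ _ "\<lambda>j. if j = i then 1 else 0"]) auto
qed

section \<open>Univariate polynomials evaluated at a multivariate one\<close>

definition upoly :: "('v::finite, 'a::comm_ring_1) mvpoly \<Rightarrow> 'a poly \<Rightarrow> ('v, 'a) mvpoly" where
  "upoly x q = poly (map_poly Const q) x"

lemma upoly_0 [simp]: "upoly x 0 = 0"
  by (simp add: upoly_def)

lemma upoly_pCons [simp]: "upoly x (pCons a q) = Const a + x * upoly x q"
  by (simp add: upoly_def map_poly_pCons)

lemma upoly_1 [simp]: "upoly x 1 = 1"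
  by (simp add: one_pCons)

lemma upoly_smult: "upoly x (smult a q) = Const a * upoly x q"
  by (induction q) (auto simp: Const_mult algebra_simps)

lemma upoly_add: "upoly x (p + q) = upoly x p + upoly x q"
proof (induction p arbitrary: q)
  case (pCons a p)
  obtain b q' where "q = pCons b q'" by (cases q)
  then show ?case by (simp add: pCons.IH Const_add algebra_simps)
qed simp

lemma upoly_mult: "upoly x (p * q) = upoly x p * upoly x q"
  by (induction p) (auto simp: upoly_add upoly_smult algebra_simps)

lemma upoly_power: "upoly x (p ^ k) = upoly x p ^ k"
  by (induction k) (auto simp: upoly_mult)

lemma upoly_sum: "upoly x (sum f A) = (\<Sum>a\<in>A. upoly x (f a))"
  by (induction A rule: infinite_finite_induct) (auto simp: upoly_add)

lemma upoly_prod: "upoly x (prod f A) = (\<Prod>a\<in>A. upoly x (f a))"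
  by (induction A rule: infinite_finite_induct) (auto simp: upoly_mult)

lemma upoly_linear: "upoly x [:- c, 1:] = x - Const c"
  by (simp add: Const_uminus)

lemma mvpoly_eval_upoly: "mvpoly_eval (upoly p q) z = poly q (mvpoly_eval p z)"
  by (induction q) auto

section \<open>Nullstellensatz\<close>

text \<open>
  If \<open>x\<^sub>j - c\<close> were a unit modulo \<open>J\<close> for uncountably many \<open>c\<close>, the inverses would be
  linearly dependent because the polynomial ring has countable dimension; clearing
  denominators in a linear relation gives a polynomial in \<open>x\<^sub>j\<close> alone.
\<close>

lemma ideal_contains_upoly:
  fixes J :: "('v::finite, complex) mvpoly set"
  assumes J: "is_ideal J" and "finite S"
    and unit: "\<And>c. c \<notin> S \<Longrightarrow> 1 \<in> adjoin J (Var j - Const c)"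
  shows "\<exists>q. q \<noteq> 0 \<and> upoly (Var j) q \<in> J"
proof -
  let ?X = "Var j :: ('v, complex) mvpoly"
  have "\<forall>c. \<exists>u. c \<notin> S \<longrightarrow> u * (?X - Const c) - 1 \<in> J"
    using unit J by (metis one_in_adjoinE)
  then obtain u where u: "\<And>c. c \<notin> S \<Longrightarrow> u c * (?X - Const c) - 1 \<in> J"
    by metis
  have "\<exists>d. \<forall>c. u c \<in> lowdeg (d c)"
    by (intro choice allI lowdeg_exists)
  then obtain d where d: "\<And>c. u c \<in> lowdeg (d c)" by blast
  \<comment> \<open>Pigeonhole: countably many degrees are distributed over uncountably many
    \<open>c\<close>, so infinitely many of the inverses \<open>u c\<close> lie in one
    finite-dimensional space.\<close>
  have "\<exists>M. infinite {c. c \<notin> S \<and> d c = M}"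
  proof (rule ccontr)
    assume "\<nexists>M. infinite {c. c \<notin> S \<and> d c = M}"
    then have "countable (\<Union>M. {c. c \<notin> S \<and> d c = M})"
      by (intro countable_UN) (auto intro: countable_finite)
    then have "countable (S \<union> (\<Union>M. {c. c \<notin> S \<and> d c = M}))"
      using \<open>finite S\<close> by (simp add: countable_finite)
    moreover have "S \<union> (\<Union>M. {c. c \<notin> S \<and> d c = M}) = UNIV" by auto
    ultimately show False using uncountable_UNIV_complex by simp
  qed
  then obtain M where M: "infinite {c. c \<notin> S \<and> d c = M}" by blast
  define E where "E = {e :: 'v \<Rightarrow>\<^sub>0 nat. mdeg e \<le> M}"
  \<comment> \<open>One more inverse than there are monomials of degree at most \<open>M\<close>
    forces a linear relation.\<close>
  obtain F where F: "finite F" "card F = card E + 1" "F \<subseteq> {c. c \<notin> S \<and> d c = M}"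
    using infinite_arbitrarily_large[OF M] by metis
  have "finite E" by (simp add: E_def finite_mdeg_le)
  with F obtain l where l: "\<exists>c\<in>F. l c \<noteq> 0"
      "\<And>e. e \<in> E \<Longrightarrow> (\<Sum>c\<in>F. lookup (u c) e * l c) = 0"
    using underdetermined_system[of E F "\<lambda>e c. lookup (u c) e"] by auto
  have rel: "(\<Sum>c\<in>F. Const (l c) * u c) = 0"
  proof (rule poly_mapping_eqI)
    fix e
    have "lookup (u c) e = 0" if "e \<notin> E" "c \<in> F" for c
      using d[of c] that F by (auto simp: E_def lowdeg_def in_keys_iff)
    then have "(\<Sum>c\<in>F. lookup (u c) e * l c) = 0"
      using l(2) by (cases "e \<in> E") auto
    then show "lookup (\<Sum>c\<in>F. Const (l c) * u c) e = lookup 0 e"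
      unfolding lookup_sum lookup_Const_mult by (simp add: mult.commute)
  qed
  \<comment> \<open>The relation reads \<open>\<Sum> l c / (x - c) = 0\<close> modulo
    \<open>J\<close>; \<open>q\<close> is its left side multiplied by all the denominators. It is
    nonzero because at a point \<open>c0\<close> of \<open>F\<close> with
    \<open>l c0 \<noteq> 0\<close> only the summand of \<open>c0\<close> survives.\<close>
  define q where "q = (\<Sum>c\<in>F. smult (l c) (\<Prod>c'\<in>F - {c}. [:- c', 1:]))"
  have upoly_q: "upoly ?X q = (\<Sum>c\<in>F. Const (l c) * (\<Prod>c'\<in>F - {c}. ?X - Const c'))"
    by (simp add: q_def upoly_sum upoly_smult upoly_prod upoly_linear del: upoly_pCons)
  have "Const (l c) * (u c * (\<Prod>c'\<in>F. ?X - Const c') - (\<Prod>c'\<in>F - {c}. ?X - Const c')) \<in> J"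
    if "c \<in> F" for c
  proof -
    have "u c * (\<Prod>c'\<in>F. ?X - Const c') - (\<Prod>c'\<in>F - {c}. ?X - Const c')
        = (\<Prod>c'\<in>F - {c}. ?X - Const c') * (u c * (?X - Const c) - 1)"
      by (subst prod.remove[OF F(1) that]) (simp add: algebra_simps)
    moreover have "u c * (?X - Const c) - 1 \<in> J" using u that F by auto
    ultimately show ?thesis using ideal_mult[OF J] by metis
  qed
  then have "(\<Sum>c\<in>F. Const (l c) * (u c * (\<Prod>c'\<in>F. ?X - Const c') - (\<Prod>c'\<in>F - {c}. ?X - Const c'))) \<in> J"
    by (rule ideal_sum[OF J])
  also have "(\<Sum>c\<in>F. Const (l c) * (u c * (\<Prod>c'\<in>F. ?X - Const c') - (\<Prod>c'\<in>F - {c}. ?X - Const c')))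
      = (\<Sum>c\<in>F. Const (l c) * u c) * (\<Prod>c'\<in>F. ?X - Const c') - upoly ?X q"
    unfolding upoly_q sum_distrib_right sum_subtractf[symmetric]
    by (rule sum.cong) (auto simp: algebra_simps)
  finally have "upoly ?X q \<in> J"
    using ideal_uminus[OF J, of "- upoly ?X q"] by (simp add: rel)
  moreover have "q \<noteq> 0"
  proof -
    obtain c0 where c0: "c0 \<in> F" "l c0 \<noteq> 0" using l by blast
    have "poly q c0 = (\<Sum>c\<in>F. if c = c0 then l c0 * (\<Prod>c'\<in>F - {c0}. c0 - c') else 0)"
      unfolding q_def poly_sum
    proof (rule sum.cong)
      fix c assume "c \<in> F"
      show "poly (smult (l c) (\<Prod>c'\<in>F - {c}. [:- c', 1:])) c0
          = (if c = c0 then l c0 * (\<Prod>c'\<in>F - {c0}. c0 - c') else 0)"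
        using c0 F(1) by (auto simp: poly_prod)
    qed simp
    then have "poly q c0 \<noteq> 0" using c0 F(1) by auto
    then show ?thesis by auto
  qed
  ultimately show ?thesis by blast
qed

text \<open>Over the complex numbers \<open>q\<close> splits into linear factors. Each factor
  \<open>x - c\<close> is invertible modulo \<open>J\<close>, so the factors can be cancelled one
  after the other until a nonzero constant remains in \<open>J\<close>.\<close>

lemma one_in_ideal_if_upoly:
  fixes J :: "('v::finite, complex) mvpoly set"
  assumes J: "is_ideal J" and unit: "\<And>c. 1 \<in> adjoin J (x - Const c)"
    and "q \<noteq> 0" "upoly x q \<in> J"
  shows "1 \<in> J"
  using assms(3,4)
proof (induction "degree q" arbitrary: q)
  case 0
  then obtain a where "q = [:a:]" "a \<noteq> 0" by (metis degree_eq_zeroE pCons_0_0)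
  then have "Const (inverse a) * upoly x q = 1"
    by (simp flip: Const_mult)
  with 0 ideal_mult[OF J] show ?case by metis
next
  case (Suc n)
  then have "\<not> constant (poly q)" by (metis constant_degree nat.distinct(1))
  then obtain c where "poly q c = 0" using fundamental_theorem_of_algebra by blast
  then obtain q' where q': "q = [:- c, 1:] * q'" by (metis dvdE poly_eq_0_iff_dvd)
  with Suc.prems have "q' \<noteq> 0" by auto
  then have "degree q = degree q' + 1"
    unfolding q' by (subst degree_mult_eq) auto
  with Suc.hyps have "n = degree q'" by simp
  obtain u where "u * (x - Const c) - 1 \<in> J"
    using unit[of c] J by (metis one_in_adjoinE)
  then have "upoly x q' * (u * (x - Const c) - 1) \<in> J" by (rule ideal_mult[OF J])
  moreover have "u * upoly x q \<in> J" by (rule ideal_mult[OF J]) (rule Suc.prems)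
  moreover have "upoly x q = (x - Const c) * upoly x q'"
    unfolding q' upoly_mult upoly_linear ..
  ultimately have "u * ((x - Const c) * upoly x q') - upoly x q' * (u * (x - Const c) - 1) \<in> J"
    by (metis ideal_diff[OF J])
  then have "upoly x q' \<in> J" by (simp add: algebra_simps)
  then show ?case using Suc.hyps(1)[OF \<open>n = degree q'\<close>] \<open>q' \<noteq> 0\<close> by blast
qed

text \<open>If every \<open>c\<close> failed, all \<open>x\<^sub>j - c\<close> would be units modulo
  \<open>J\<close>. Then \<open>J\<close> would contain a nonzero polynomial in
  \<open>x\<^sub>j\<close>, and cancelling its linear factors would put 1 into
  \<open>J\<close>.\<close>

lemma proper_adjoin_exists:
  fixes J :: "('v::finite, complex) mvpoly set"
  assumes "is_ideal J" "1 \<notin> J"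
  shows "\<exists>c. 1 \<notin> adjoin J (Var j - Const c)"
  using ideal_contains_upoly[OF assms(1), of "{}" j] one_in_ideal_if_upoly[OF assms(1)] assms(2)
  by blast

text \<open>The coordinates of the zero are chosen one at a time, keeping the enlarged ideal proper.
  In the end every polynomial is congruent to its value at the chosen point, and a proper ideal
  contains no nonzero constant.\<close>

theorem weak_Nullstellensatz:
  fixes J :: "('v::finite, complex) mvpoly set"
  assumes "is_ideal J" "1 \<notin> J"
  shows "\<exists>z. \<forall>p\<in>J. mvpoly_eval p z = 0"
proof -
  have "\<exists>J' z. is_ideal J' \<and> J \<subseteq> J' \<and> 1 \<notin> J' \<and> (\<forall>i\<in>A. Var i - Const (z i) \<in> J')"
    if "finite A" for A :: "'v set"
    using that
  proof (induction A rule: finite_induct)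
    case empty
    then show ?case using assms by blast
  next
    case (insert j A)
    then obtain J' z where J': "is_ideal J'" "J \<subseteq> J'" "1 \<notin> J'" "\<forall>i\<in>A. Var i - Const (z i) \<in> J'"
      by blast
    obtain c where c: "1 \<notin> adjoin J' (Var j - Const c)"
      using proper_adjoin_exists[OF J'(1,3)] by blast
    let ?J = "adjoin J' (Var j - Const c)"
    have "\<forall>i\<in>insert j A. Var i - Const ((z(j := c)) i) \<in> ?J"
      using insert.hyps J'(4) in_adjoin[OF J'(1)] subset_adjoin[OF J'(1)] by auto
    then show ?case
      using ideal_adjoin[OF J'(1)] subset_adjoin[OF J'(1)] J'(2) c by blast
  qed
  from this[of UNIV] obtain J' z where J': "is_ideal J'" "J \<subseteq> J'" "1 \<notin> J'"
    "\<And>i. Var i - Const (z i) \<in> J'" by auto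
  let ?z = "\<chi> i. z i"
  have cong: "p - Const (mvpoly_eval p ?z) \<in> J'" for p
  proof (induction p rule: mvpoly_induct)
    case (Const c)
    then show ?case using ideal_0[OF J'(1)] by simp
  next
    case (Var i)
    then show ?case using J'(4) by simp
  next
    case (add p q)
    from ideal_add[OF J'(1) this] show ?case by (simp add: Const_add algebra_simps)
  next
    case (mult p q)
    have "q * (p - Const (mvpoly_eval p ?z)) + Const (mvpoly_eval p ?z) * (q - Const (mvpoly_eval q ?z)) \<in> J'"
      by (intro ideal_add[OF J'(1)] ideal_mult[OF J'(1)] mult)
    then show ?case by (simp add: Const_mult algebra_simps)
  qed
  have "mvpoly_eval p ?z = 0" if "p \<in> J" for p
  proof (rule ccontr)
    assume nz: "mvpoly_eval p ?z \<noteq> 0"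
    have "p - (p - Const (mvpoly_eval p ?z)) \<in> J'"
      using that J'(2) by (intro ideal_diff[OF J'(1)] cong) auto
    then have "Const (inverse (mvpoly_eval p ?z)) * Const (mvpoly_eval p ?z) \<in> J'"
      by (intro ideal_mult[OF J'(1)]) simp
    with nz J'(3) show False by (simp flip: Const_mult)
  qed
  then show ?thesis by blast
qed

text \<open>If \<open>c\<close> is not the \<open>j\<close>-th coordinate of a zero of
  \<open>J\<close>, then \<open>J\<close> together with \<open>x\<^sub>j - c\<close> has no zero and
  hence contains 1. Only finitely many \<open>c\<close> are excluded.\<close>

lemma finite_zeros_imp_upoly:
  fixes J :: "('v::finite, complex) mvpoly set"
  assumes J: "is_ideal J" and fin: "finite {z. \<forall>p\<in>J. mvpoly_eval p z = 0}"
  shows "\<exists>q. q \<noteq> 0 \<and> upoly (Var j) q \<in> J"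
proof (rule ideal_contains_upoly[OF J finite_imageI[OF fin, of "\<lambda>z. z $ j"]])
  fix c assume c: "c \<notin> (\<lambda>z. z $ j) ` {z. \<forall>p\<in>J. mvpoly_eval p z = 0}"
  show "1 \<in> adjoin J (Var j - Const c)"
  proof (rule ccontr)
    assume "1 \<notin> adjoin J (Var j - Const c)"
    then obtain z where z: "\<forall>p\<in>adjoin J (Var j - Const c). mvpoly_eval p z = 0"
      using weak_Nullstellensatz ideal_adjoin[OF J] by blast
    with in_adjoin[OF J] have "z $ j = c" by fastforce
    moreover have "\<forall>p\<in>J. mvpoly_eval p z = 0" using z subset_adjoin[OF J] by blast
    ultimately show False using c by blast
  qed
qed

section \<open>Analytic independence at isolated zeros\<close>

text \<open>Exponents of elements of \<open>A\<close> are digits in a base \<open>B\<close> larger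
  than all of them, and the weights are powers of \<open>B\<close>. The result is an additive
  tie-breaker between exponent vectors of equal degree.\<close>

lemma injective_weight_exists:
  fixes A :: "('v::finite \<Rightarrow>\<^sub>0 nat) set"
  assumes "finite A"
  shows "\<exists>w. inj_on (\<lambda>a. \<Sum>i\<in>UNIV. lookup a i * w i) A"
proof -
  define B where "B = Suc (\<Sum>a\<in>A. mdeg a)"
  have B: "lookup a i < B" if "a \<in> A" for a i
  proof -
    have "lookup a i \<le> mdeg a" by (rule lookup_le_mdeg)
    also have "\<dots> \<le> (\<Sum>a\<in>A. mdeg a)" using assms that by (intro member_le_sum) auto
    finally show ?thesis by (simp add: B_def)
  qed
  have "\<exists>w. \<forall>a\<in>A. \<forall>b\<in>A. (\<Sum>i\<in>S. lookup a i * w i) = (\<Sum>i\<in>S. lookup b i * w i) \<longrightarrow>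
      (\<forall>i\<in>S. lookup a i = lookup b i)" if "finite S" for S :: "'v set"
    using that
  proof (induction S rule: finite_induct)
    case (insert v S)
    then obtain w where w: "\<And>a b. a \<in> A \<Longrightarrow> b \<in> A \<Longrightarrow>
        (\<Sum>i\<in>S. lookup a i * w i) = (\<Sum>i\<in>S. lookup b i * w i) \<Longrightarrow> \<forall>i\<in>S. lookup a i = lookup b i"
      by blast
    define w' where "w' = (\<lambda>i. if i = v then 1 else B * w i)"
    have sum: "(\<Sum>i\<in>insert v S. lookup a i * w' i) = lookup a v + B * (\<Sum>i\<in>S. lookup a i * w i)" for a
    proof -
      have "(\<Sum>i\<in>S. lookup a i * w' i) = (\<Sum>i\<in>S. B * (lookup a i * w i))"
        using insert.hyps by (intro sum.cong) (auto simp: w'_def)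
      then show ?thesis using insert.hyps by (simp add: w'_def sum_distrib_left)
    qed
    show ?case
    proof (intro exI[of _ w'] ballI impI)
      fix a b i
      assume ab: "a \<in> A" "b \<in> A" and i: "i \<in> insert v S"
        and "(\<Sum>i\<in>insert v S. lookup a i * w' i) = (\<Sum>i\<in>insert v S. lookup b i * w' i)"
      then have eq: "lookup a v + B * (\<Sum>i\<in>S. lookup a i * w i) = lookup b v + B * (\<Sum>i\<in>S. lookup b i * w i)"
        by (simp only: sum)
      from arg_cong[OF eq, of "\<lambda>x. x mod B"] have v: "lookup a v = lookup b v"
        using B ab by simp
      with eq have "B * (\<Sum>i\<in>S. lookup a i * w i) = B * (\<Sum>i\<in>S. lookup b i * w i)"
        by simp
      moreover have "B \<noteq> 0" by (simp add: B_def)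
      ultimately have "(\<Sum>i\<in>S. lookup a i * w i) = (\<Sum>i\<in>S. lookup b i * w i)"
        by (simp only: mult_cancel1 simp_thms)
      with w[OF ab] v i show "lookup a i = lookup b i" by auto
    qed
  qed auto
  from this[of UNIV] show ?thesis
    by (auto simp: inj_on_def poly_mapping_eq_iff fun_eq_iff)
qed

lemma is_ideal_hideg: "is_ideal (hideg T :: ('v::finite, 'a::comm_ring_1) mvpoly set)"
  unfolding is_ideal_def
proof (intro conjI ballI allI)
  fix a b :: "('v, 'a) mvpoly" assume "a \<in> hideg T" "b \<in> hideg T"
  then show "a + b \<in> hideg T"
    using keys_add[of a b] unfolding hideg_def by blast
next
  fix a r :: "('v, 'a) mvpoly" assume "a \<in> hideg T"
  then show "r * a \<in> hideg T" using hideg_mult[of r 0 a T] by simp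
qed auto

text \<open>Pigeonhole: a monomial of degree at least \<open>\<Sum> k j\<close> is divisible by some
  \<open>x\<^sub>j\<close> to the power \<open>k j\<close>.\<close>

lemma hideg_subset_ideal:
  fixes J :: "('v::finite, 'a::field) mvpoly set"
  assumes J: "is_ideal J" and k: "\<And>j. Var j ^ k j \<in> J"
  shows "hideg (\<Sum>j\<in>UNIV. k j) \<subseteq> J"
proof
  fix p :: "('v, 'a) mvpoly" assume p: "p \<in> hideg (\<Sum>j\<in>UNIV. k j)"
  have "single e (lookup p e) \<in> J" if "e \<in> keys p" for e
  proof -
    have "\<exists>j. k j \<le> lookup e j"
    proof (rule ccontr)
      assume "\<nexists>j. k j \<le> lookup e j"
      then have "mdeg e < (\<Sum>j\<in>UNIV. k j)"
        unfolding mdeg_def by (intro sum_strict_mono) (auto simp: not_le)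
      with p that show False by (auto simp: hideg_def)
    qed
    then obtain j where j: "k j \<le> lookup e j" by blast
    have e: "e = (e - single j (k j)) + single j (k j)"
      by (rule poly_mapping_eqI) (use j in \<open>auto simp: lookup_add lookup_minus lookup_single when_def\<close>)
    have "single e (lookup p e) = Const (lookup p e) * mpow Var (e - single j (k j)) * Var j ^ k j"
      unfolding single_eq_Const_mpow by (subst e) (simp add: mpow_add mult.assoc)
    then show ?thesis using ideal_mult[OF J k] by metis
  qed
  then show "p \<in> J"
    by (subst sum_single_keys) (rule ideal_sum[OF J])
qed

text \<open>Near the origin \<open>u\<close> is a unit, so locally a power of each variable lies in
  the ideal of \<open>f\<close>. Working modulo \<open>hideg T\<close> replaces the local ring. It
  matters that \<open>K\<close> does not depend on \<open>T\<close>.\<close>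

lemma hideg_subset_idl_mod:
  fixes f :: "'v::finite \<Rightarrow> ('v, 'a::field) mvpoly"
  assumes "\<And>j. \<exists>k u. mvpoly_eval u 0 \<noteq> 0 \<and> Var j ^ k * u \<in> idl f"
  shows "\<exists>K. \<forall>T. \<forall>p\<in>hideg K. \<exists>d\<in>hideg T. p - d \<in> idl f"
proof -
  have I: "is_ideal (idl f)" by (rule is_ideal_idl)
  obtain k u where ku: "\<And>j. mvpoly_eval (u j) 0 \<noteq> 0" "\<And>j. Var j ^ k j * u j \<in> idl f"
    using assms by metis
  have "\<exists>d\<in>hideg T. p - d \<in> idl f" if p: "p \<in> hideg (\<Sum>j\<in>UNIV. k j)" for p T
  proof -
    define J where "J = {p. \<exists>d\<in>hideg T. p - d \<in> idl f}"
    have "is_ideal J"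
      unfolding is_ideal_def
    proof (intro conjI ballI allI)
      show "0 \<in> J" unfolding J_def using ideal_0[OF I] by (auto intro!: bexI[of _ 0])
    next
      fix a b assume "a \<in> J" "b \<in> J"
      then obtain c d where "c \<in> hideg T" "d \<in> hideg T" "a - c \<in> idl f" "b - d \<in> idl f"
        by (auto simp: J_def)
      then have "c + d \<in> hideg T" "(a - c) + (b - d) \<in> idl f"
        using ideal_add[OF is_ideal_hideg] ideal_add[OF I] by blast+
      then show "a + b \<in> J" unfolding J_def by (auto intro!: bexI[of _ "c + d"] simp: algebra_simps)
    next
      fix a r assume "a \<in> J"
      then obtain c where "c \<in> hideg T" "a - c \<in> idl f" by (auto simp: J_def)
      then have "r * c \<in> hideg T" "r * (a - c) \<in> idl f"
        using ideal_mult[OF is_ideal_hideg] ideal_mult[OF I] by blast+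
      then show "r * a \<in> J" unfolding J_def by (auto intro!: bexI[of _ "r * c"] simp: algebra_simps)
    qed
    moreover have "Var j ^ k j \<in> J" for j
    proof -
      \<comment> \<open>\<open>u\<close> scaled to have value 1 at the origin. The finite geometric
        series in \<open>1 - v\<close> inverts \<open>v\<close> up to the error
        \<open>(1 - v) ^ T\<close>, which lies in \<open>hideg T\<close>.\<close>
      define v where "v = Const (inverse (mvpoly_eval (u j) 0)) * u j"
      have "Const (inverse (mvpoly_eval (u j) 0)) * (Var j ^ k j * u j) \<in> idl f"
        by (rule ideal_mult[OF I ku(2)])
      then have v: "Var j ^ k j * v \<in> idl f"
        by (simp add: v_def mult.left_commute)
      have "1 - v \<in> hideg 1"
        unfolding hideg_1_iff using ku(1)[of j] by (simp add: v_def)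
      then have d: "Var j ^ k j * (1 - v) ^ T \<in> hideg T"
        using hideg_power[of "1 - v" 1 T] by (intro ideal_mult[OF is_ideal_hideg]) simp
      have "Var j ^ k j - Var j ^ k j * (1 - v) ^ T = Var j ^ k j * (1 - (1 - v) ^ T)"
        by (simp add: algebra_simps)
      also have "\<dots> = (\<Sum>i<T. (1 - v) ^ i) * (Var j ^ k j * v)"
        by (simp add: one_diff_power_eq mult_ac)
      also have "\<dots> \<in> idl f" by (rule ideal_mult[OF I v])
      finally show ?thesis unfolding J_def using d by blast
    qed
    ultimately have "p \<in> J" using hideg_subset_ideal p by blast
    then show ?thesis by (simp add: J_def)
  qed
  then show ?thesis by blast
qed

text \<open>A terminating rewriting procedure, in which \<open>s\<close> bounds from below the order
  of the coefficient \<open>p\<close>. If \<open>s\<close> reaches \<open>K\<close>, then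
  \<open>p\<close> is an element of the ideal of \<open>f\<close> up to \<open>hideg T\<close>, and
  the degree of the power product grows. Otherwise a monomial of \<open>p\<close> of degree
  \<open>s\<close> either meets an \<open>a\<close> not divisible by \<alpha>, which is covered by
  the hypothesis on \<open>W\<close>, or the relation replaces \<open>f\<^sup>\<alpha>\<close>. Each
  replacement raises the degree of the power product, or keeps it and raises \<open>s\<close>, or
  keeps both and lowers the weight.\<close>

lemma rewriting_spans:
  fixes f :: "'v::finite \<Rightarrow> ('v, 'a::field) mvpoly" and wt :: "('v \<Rightarrow>\<^sub>0 nat) \<Rightarrow> nat"
  assumes f: "\<And>i. f i \<in> hideg 1"
    and K: "\<And>p. p \<in> hideg K \<Longrightarrow> \<exists>d\<in>hideg T. p - d \<in> idl f"
    and rel: "mpow f \<alpha> = (\<Sum>k\<in>L. g k * mpow f (B k))"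
    and L: "\<And>k. k \<in> L \<Longrightarrow> mdeg \<alpha> < mdeg (B k) \<or>
        mdeg (B k) = mdeg \<alpha> \<and> (g k \<in> hideg 1 \<or> wt (B k) < wt \<alpha>)"
    and wt: "\<And>a b. wt (a + b) = wt a + wt b"
    and W0: "0 \<in> W" and W_add: "\<And>x y. x \<in> W \<Longrightarrow> y \<in> W \<Longrightarrow> x + y \<in> W" and WT: "hideg T \<subseteq> W"
    and W: "\<And>b a c. mdeg b < K \<Longrightarrow> mdeg a < T \<Longrightarrow> \<exists>i. lookup a i < lookup \<alpha> i \<Longrightarrow>
        single b c * mpow f a \<in> W"
  shows "p * mpow f a \<in> W"
proof -
  have W_sum: "(\<And>x. x \<in> A \<Longrightarrow> h x \<in> W) \<Longrightarrow> sum h A \<in> W" for A and h :: "'c \<Rightarrow> ('v, 'a) mvpoly"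
    by (induction A rule: infinite_finite_induct) (auto intro: W0 W_add)
  have wf: "wf (less_than <*lex*> less_than <*lex*> less_than)"
    by (intro wf_lex_prod wf_less_than)
  have "\<forall>(p :: ('v, 'a) mvpoly) s a. m = (T - mdeg a, K - s, wt a) \<longrightarrow> p \<in> hideg s \<longrightarrow> p * mpow f a \<in> W" for m
  proof (induction m rule: wf_induct_rule[OF wf])
    case (1 m)
    show ?case
    proof (intro allI impI)
      fix p :: "('v, 'a) mvpoly" and s a
      assume m: "m = (T - mdeg a, K - s, wt a)" and p: "p \<in> hideg s"
      have IH: "q * mpow f b \<in> W"
        if "q \<in> hideg t" "T - mdeg b < T - mdeg a \<or>
          T - mdeg b = T - mdeg a \<and> (K - t < K - s \<or> K - t = K - s \<and> wt b < wt a)"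
        for q t and b :: "'v \<Rightarrow>\<^sub>0 nat"
      proof -
        have "((T - mdeg b, K - t, wt b), m) \<in> less_than <*lex*> less_than <*lex*> less_than"
          using that(2) unfolding m by auto
        from 1[rule_format, OF this refl that(1)] show ?thesis .
      qed
      \<comment> \<open>The degree of the power product comes first in the lexicographic measure, so
        once it grows the order of the coefficient may be reset to 0.\<close>
      have big: "q * mpow f b \<in> W" if "mdeg b > mdeg a" for q b
      proof (cases "mdeg a < T")
        case True
        with that show ?thesis by (intro IH[of _ 0]) auto
      next
        case False
        with that have "mpow f b \<in> hideg T" using hideg_mono[OF hideg_mpow[OF f]] by simp
        then show ?thesis using WT ideal_mult[OF is_ideal_hideg] by blast
      qed
      consider "mdeg a \<ge> T" | "mdeg a < T" "s \<ge> K" | "mdeg a < T" "s < K" by linarith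
      then show "p * mpow f a \<in> W"
      proof cases
        case 1
        then have "mpow f a \<in> hideg T" using hideg_mono[OF hideg_mpow[OF f]] by simp
        then show ?thesis using WT ideal_mult[OF is_ideal_hideg] by blast
      next
        case 2
        then obtain d r where d: "d \<in> hideg T" "p - d = (\<Sum>i\<in>UNIV. r i * f i)"
          using K[OF hideg_mono[OF p]] by (auto simp: idl_def)
        have "p = (\<Sum>i\<in>UNIV. r i * f i) + d" using d(2) by (simp add: algebra_simps)
        then have "p * mpow f a = (\<Sum>i\<in>UNIV. r i * mpow f (single i 1 + a)) + mpow f a * d"
          by (simp add: mpow_add algebra_simps sum_distrib_left)
        also have "\<dots> \<in> W"
        proof (intro W_add W_sum)
          show "r i * mpow f (single i 1 + a) \<in> W" for i
            by (rule big) (simp add: mdeg_add)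
          show "mpow f a * d \<in> W" using WT ideal_mult[OF is_ideal_hideg d(1)] by blast
        qed
        finally show ?thesis .
      next
        case 3
        have "single e c * mpow f a \<in> W" if e: "mdeg e \<ge> s" for e c
        proof -
          have se: "single e c \<in> hideg (mdeg e)" by (auto simp: hideg_def)
          consider "mdeg e > s" | "mdeg e = s" "\<exists>i. lookup a i < lookup \<alpha> i"
            | "mdeg e = s" "\<forall>i. lookup \<alpha> i \<le> lookup a i"
            using e by (metis le_neq_implies_less not_le)
          then show ?thesis
          proof cases
            case 1
            then show ?thesis using 3 se by (intro IH[of _ "mdeg e"]) auto
          next
            case 2
            then show ?thesis using 3 by (intro W) auto
          next
            case 3
            define a' where "a' = a - \<alpha>"
            have a: "a = \<alpha> + a'"
              by (rule poly_mapping_eqI) (simp add: a'_def lookup_add lookup_minus 3(2))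
            have "single e c * mpow f a = (\<Sum>k\<in>L. (single e c * g k) * mpow f (B k + a'))"
              by (simp add: a mpow_add rel sum_distrib_left sum_distrib_right mult_ac)
            also have "\<dots> \<in> W"
            proof (rule W_sum)
              fix k assume "k \<in> L"
              from L[OF this] consider "mdeg \<alpha> < mdeg (B k)" | "mdeg (B k) = mdeg \<alpha>" "g k \<in> hideg 1"
                | "mdeg (B k) = mdeg \<alpha>" "wt (B k) < wt \<alpha>" by blast
              then show "(single e c * g k) * mpow f (B k + a') \<in> W"
              proof cases
                case 1
                then show ?thesis by (intro big) (simp add: a mdeg_add)
              next
                case 2
                then have "single e c * g k \<in> hideg (s + 1)"
                  using hideg_mult[OF se, of "g k" 1] 3 by simp
                then show ?thesis using 2 \<open>s < K\<close> by (intro IH) (auto simp: a mdeg_add)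
              next
                case 3
                then have "single e c * g k \<in> hideg s"
                  using hideg_mult[OF se, of "g k" 0] \<open>mdeg e = s\<close> by simp
                then show ?thesis using 3 by (intro IH) (auto simp: a mdeg_add wt)
              qed
            qed
            finally show ?thesis .
          qed
        qed
        then have "(\<Sum>e\<in>keys p. single e (lookup p e) * mpow f a) \<in> W"
          using p by (intro W_sum) (auto simp: hideg_def)
        then show ?thesis
          by (subst sum_single_keys[of p]) (simp add: sum_distrib_right)
      qed
    qed
  qed
  then show ?thesis using hideg_0 by blast
qed

text \<open>
  Analytic independence of \<open>f\<close> at an isolated zero. Modulo the \<open>T\<close>-th power of the maximal
  ideal, the relation allows to rewrite every polynomial in terms of \<open>b f\<^sup>a\<close> with boundedly many
  monomials \<open>b\<close> and exponents \<open>a\<close> not divisible by \<open>\<alpha>\<close>; there are only \<open>O(T\<^sup>N\<^sup>-\<^sup>1)\<close> of these, but the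
  quotient has dimension of order \<open>T\<^sup>N\<close>.
\<close>

lemma no_relation_at_isolated_zero:
  fixes f :: "'v::finite \<Rightarrow> ('v, 'a::field) mvpoly" and wt :: "('v \<Rightarrow>\<^sub>0 nat) \<Rightarrow> nat"
  assumes f: "\<And>i. f i \<in> hideg 1"
    and isolated: "\<And>j. \<exists>k u. mvpoly_eval u 0 \<noteq> 0 \<and> Var j ^ k * u \<in> idl f"
    and wt: "\<And>a b. wt (a + b) = wt a + wt b"
    and L: "\<And>k. k \<in> L \<Longrightarrow> mdeg \<alpha> < mdeg (B k) \<or>
        mdeg (B k) = mdeg \<alpha> \<and> (g k \<in> hideg 1 \<or> wt (B k) < wt \<alpha>)"
  shows "mpow f \<alpha> \<noteq> (\<Sum>k\<in>L. g k * mpow f (B k))"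
proof
  assume rel: "mpow f \<alpha> = (\<Sum>k\<in>L. g k * mpow f (B k))"
  let ?N = "CARD('v)"
  obtain K where K: "\<And>T p. p \<in> hideg K \<Longrightarrow> \<exists>d\<in>hideg T. p - d \<in> idl f"
    using hideg_subset_idl_mod[OF isolated] by blast
  \<comment> \<open>Chosen so that \<open>\<tau>\<^sup>N\<close> exceeds the number of pairs in
    \<open>B1 \<times> B2\<close>. With \<open>T = N * \<tau>\<close> the cube of exponents below
    \<tau> consists of vectors of degree less than \<open>T\<close>, and \<tau> is larger by one
    than the constant in front of \<open>\<tau> ^ (N - 1)\<close>.\<close>
  define \<tau> where "\<tau> = K ^ ?N * (mdeg \<alpha> * ?N ^ (?N - 1)) + 1"
  define T where "T = ?N * \<tau>"
  define E where "E = {e :: 'v \<Rightarrow>\<^sub>0 nat. mdeg e < T}"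
  define B1 where "B1 = {b :: 'v \<Rightarrow>\<^sub>0 nat. mdeg b < K}"
  define B2 where "B2 = {a :: 'v \<Rightarrow>\<^sub>0 nat. mdeg a < T \<and> (\<exists>i. lookup a i < lookup \<alpha> i)}"
  have fin: "finite E" "finite B1" "finite B2"
    unfolding E_def B1_def B2_def using finite_mdeg_less
    by (auto intro: finite_subset[OF _ finite_mdeg_less[of T]])
  have pow: "x ^ ?N = x * x ^ (?N - 1)" for x :: nat
    by (simp add: power_eq_if)
  have "card B1 \<le> card {e :: 'v \<Rightarrow>\<^sub>0 nat. \<forall>i. lookup e i \<in> {..<K}}"
    unfolding B1_def by (intro card_mono exponent_box) (auto intro: le_less_trans[OF lookup_le_mdeg])
  also have "\<dots> = K ^ ?N" by (subst exponent_box) auto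
  finally have card_B1: "card B1 \<le> K ^ ?N" .
  \<comment> \<open>An exponent vector not divisible by \<alpha> is bounded in some coordinate
    \<open>j\<close> by the fixed number \<open>lookup \<alpha> j\<close>, which costs one factor
    \<open>T\<close>.\<close>
  have "B2 \<subseteq> (\<Union>j. {e. \<forall>i. lookup e i \<in> (if i = j then {..<lookup \<alpha> j} else {..<T})})"
    unfolding B2_def by (auto intro: le_less_trans[OF lookup_le_mdeg])
  then have "card B2 \<le> card (\<Union>j. {e. \<forall>i. lookup e i \<in> (if i = j then {..<lookup \<alpha> j} else {..<T})})"
    by (intro card_mono finite_UN_I exponent_box) auto
  also have "\<dots> \<le> (\<Sum>j\<in>UNIV. card {e. \<forall>i. lookup e i \<in> (if i = j then {..<lookup \<alpha> j} else {..<T})})"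
    by (rule card_UN_le) simp
  also have "\<dots> = (\<Sum>j\<in>UNIV. lookup \<alpha> j * T ^ (?N - 1))"
  proof (rule sum.cong)
    fix j :: 'v
    have "card {e. \<forall>i. lookup e i \<in> (if i = j then {..<lookup \<alpha> j} else {..<T})}
        = (\<Prod>i\<in>UNIV. if i = j then lookup \<alpha> j else T)"
      by (subst exponent_box) (auto intro!: prod.cong)
    also have "\<dots> = lookup \<alpha> j * (\<Prod>i\<in>UNIV - {j}. T)"
      by (subst prod.remove[of _ j]) (auto intro!: prod.cong)
    finally show "card {e. \<forall>i. lookup e i \<in> (if i = j then {..<lookup \<alpha> j} else {..<T})}
        = lookup \<alpha> j * T ^ (?N - 1)" by (simp add: card_Diff_singleton)
  qed simp
  also have "\<dots> = mdeg \<alpha> * T ^ (?N - 1)" by (simp add: mdeg_def sum_distrib_right)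
  finally have card_B2: "card B2 \<le> mdeg \<alpha> * T ^ (?N - 1)" .
  have "\<tau> ^ ?N = card {e :: 'v \<Rightarrow>\<^sub>0 nat. \<forall>i. lookup e i \<in> {..<\<tau>}}"
    by (subst exponent_box) auto
  also have "\<dots> \<le> card E"
  proof (intro card_mono fin subsetI)
    fix e :: "'v \<Rightarrow>\<^sub>0 nat" assume "e \<in> {e. \<forall>i. lookup e i \<in> {..<\<tau>}}"
    then have "mdeg e < (\<Sum>i\<in>(UNIV :: 'v set). \<tau>)"
      unfolding mdeg_def by (intro sum_strict_mono) auto
    then show "e \<in> E" by (simp add: E_def T_def)
  qed
  finally have card_E: "\<tau> ^ ?N \<le> card E" .
  have "card (B1 \<times> B2) \<le> K ^ ?N * (mdeg \<alpha> * T ^ (?N - 1))"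
    unfolding card_cartesian_product by (intro mult_mono card_B1 card_B2) auto
  also have "\<dots> = (K ^ ?N * (mdeg \<alpha> * ?N ^ (?N - 1))) * \<tau> ^ (?N - 1)"
    by (simp add: T_def power_mult_distrib)
  also have "\<dots> < \<tau> ^ ?N"
    unfolding pow[of \<tau>] by (intro mult_strict_right_mono) (auto simp: \<tau>_def)
  finally have "card (B1 \<times> B2) < card E" using card_E by simp
  then obtain l where l: "\<exists>e\<in>E. l e \<noteq> 0"
    and l_eq: "\<forall>y\<in>B1 \<times> B2. (\<Sum>e\<in>E. lookup (single (fst y) 1 * mpow f (snd y)) e * l e) = 0"
    using underdetermined_system[of "B1 \<times> B2" E "\<lambda>y e. lookup (single (fst y) 1 * mpow f (snd y)) e"] fin
    by blast
  have eq: "(\<Sum>e\<in>E. lookup (single b 1 * mpow f a) e * l e) = 0" if "b \<in> B1" "a \<in> B2" for b a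
    using bspec[OF l_eq, of "(b, a)"] that by simp
  \<comment> \<open>The kernel of the functional with coefficients \<open>l\<close>. It contains
    \<open>hideg T\<close> and all the products counted above, so rewriting makes it the whole ring,
    although the functional is not zero.\<close>
  define W where "W = {p :: ('v, 'a) mvpoly. (\<Sum>e\<in>E. lookup p e * l e) = 0}"
  have "p * mpow f 0 \<in> W" for p
  proof (rule rewriting_spans[where K = K and T = T and L = L and g = g and B = B and wt = wt])
    show "0 \<in> W" by (simp add: W_def)
    show "x + y \<in> W" if "x \<in> W" "y \<in> W" for x y
      using that by (simp add: W_def lookup_add distrib_right sum.distrib)
    show "hideg T \<subseteq> W"
    proof
      fix p :: "('v, 'a) mvpoly" assume "p \<in> hideg T"
      then have "lookup p e = 0" if "e \<in> E" for e
        using that by (force simp: E_def hideg_def in_keys_iff)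
      then show "p \<in> W" by (simp add: W_def)
    qed
    show "single b c * mpow f a \<in> W"
      if "mdeg b < K" "mdeg a < T" "\<exists>i. lookup a i < lookup \<alpha> i" for b a c
    proof -
      have "single b c * mpow f a = Const c * (single b 1 * mpow f a)"
        by (simp add: Const_mult_single flip: mult.assoc)
      moreover have "(\<Sum>e\<in>E. lookup (single b 1 * mpow f a) e * l e) = 0"
        using that by (intro eq) (auto simp: B1_def B2_def)
      ultimately show ?thesis
        by (simp add: W_def lookup_Const_mult mult.assoc flip: sum_distrib_left)
    qed
  qed (use f K rel L wt in auto)
  then have W: "p \<in> W" for p by simp
  obtain e0 where e0: "e0 \<in> E" "l e0 \<noteq> 0" using l by blast
  have "(\<Sum>e\<in>E. lookup (single e0 1) e * l e) = (\<Sum>e\<in>E. if e = e0 then l e0 else 0)"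
    by (rule sum.cong) (auto simp: lookup_single when_def)
  with W[of "single e0 1"] e0 fin show False by (simp add: W_def)
qed

section \<open>Interpolation at the zeros and independence over the algebra generated by the
  system\<close>

lemma interpolating_polynomial_exists:
  fixes Z :: "('a::field ^ 'v::finite) set"
  assumes "finite Z"
  shows "\<exists>h. mvpoly_eval h z = 1 \<and> (\<forall>w\<in>Z - {z}. mvpoly_eval h w = 0)"
proof -
  have "\<exists>g. mvpoly_eval g z = 1 \<and> mvpoly_eval g w = 0" if "w \<noteq> z" for w
  proof -
    obtain i where "w $ i \<noteq> z $ i" using \<open>w \<noteq> z\<close> by (auto simp: vec_eq_iff)
    then show ?thesis
      by (intro exI[of _ "Const (inverse (z $ i - w $ i)) * (Var i - Const (w $ i))"]) auto
  qed
  then obtain g where g: "\<And>w. w \<noteq> z \<Longrightarrow> mvpoly_eval (g w) z = 1 \<and> mvpoly_eval (g w) w = 0"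
    by metis
  show ?thesis
  proof (intro exI[of _ "\<Prod>w\<in>Z - {z}. g w"] conjI ballI)
    show "mvpoly_eval (\<Prod>w\<in>Z - {z}. g w) w = 0" if "w \<in> Z - {z}" for w
      using that g assms by auto
    show "mvpoly_eval (\<Prod>w\<in>Z - {z}. g w) z = 1"
      using g by (auto intro!: prod.neutral)
  qed
qed

text \<open>The ideal contains a nonzero \<open>q(x\<^sub>j)\<close>. Splitting off the full power
  of \<open>x\<^sub>j - z\<^sub>j\<close> from it leaves a cofactor that does not vanish at
  \<open>z\<close>; the shift turns this power into a power of \<open>x\<^sub>j\<close>.\<close>

lemma zero_is_isolated:
  fixes f :: "'v::finite \<Rightarrow> ('v, complex) mvpoly"
  assumes fin: "finite {z. \<forall>i. mvpoly_eval (f i) z = 0}"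
  shows "\<exists>k u. mvpoly_eval u 0 \<noteq> 0 \<and> Var j ^ k * u \<in> idl (\<lambda>i. translate z (f i))"
proof -
  have "{z. \<forall>p\<in>idl f. mvpoly_eval p z = 0} = {z. \<forall>i. mvpoly_eval (f i) z = 0}"
    (is "?A = ?B")
  proof
    show "?A \<subseteq> ?B" using generator_in_idl[of f] by blast
    show "?B \<subseteq> ?A" by (auto simp: idl_def)
  qed
  with fin have "finite {z. \<forall>p\<in>idl f. mvpoly_eval p z = 0}" by simp
  from finite_zeros_imp_upoly[OF is_ideal_idl this, of j]
  obtain q where q: "q \<noteq> 0" "upoly (Var j) q \<in> idl f" by blast
  obtain g where g: "q = [:- (z $ j), 1:] ^ order (z $ j) q * g" "\<not> [:- (z $ j), 1:] dvd g"
    using order_decomp[OF q(1), of "z $ j"] by blast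
  let ?k = "order (z $ j) q"
  have "upoly (Var j) q = (Var j - Const (z $ j)) ^ ?k * upoly (Var j) g"
    by (subst g(1)) (simp only: upoly_mult upoly_power upoly_linear)
  moreover have "translate z (Var j - Const (z $ j)) = Var j"
    by (simp add: translate_diff translate_hom)
  ultimately have "translate z (upoly (Var j) q) = Var j ^ ?k * translate z (upoly (Var j) g)"
    by (simp add: translate_hom)
  moreover have "translate z (upoly (Var j) q) \<in> idl (\<lambda>i. translate z (f i))"
    using q(2) by (auto simp: idl_def translate_hom)
  moreover have "mvpoly_eval (translate z (upoly (Var j) g)) 0 \<noteq> 0"
    using g(2) by (simp add: eval_translate mvpoly_eval_upoly poly_eq_0_iff_dvd)
  ultimately show ?thesis by metis
qed

text \<open>
  In a relation take the terms \<open>f\<^sup>a h\<^sub>z\<close> of least degree \<open>mdeg a\<close>, and one of them, \<open>(z, \<alpha>)\<close>. Modulo the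
  maximal ideal at \<open>z\<close> only \<open>h\<^sub>z\<close> survives, which leaves a relation excluded by
  analytic independence at \<open>z\<close>.
\<close>

lemma interpolating_family_independent:
  fixes f :: "'v::finite \<Rightarrow> ('v, complex) mvpoly" and h :: "complex ^ 'v \<Rightarrow> ('v, complex) mvpoly"
  assumes fin: "finite {z. \<forall>i. mvpoly_eval (f i) z = 0}"
    and h: "\<And>z w. z \<in> Z \<Longrightarrow> w \<in> Z \<Longrightarrow> mvpoly_eval (h z) w = (if z = w then 1 else 0)"
    and Z: "Z \<subseteq> {z. \<forall>i. mvpoly_eval (f i) z = 0}"
    and L: "finite L" "L \<subseteq> Z \<times> UNIV"
    and rel: "(\<Sum>(z, a)\<in>L. Const (c (z, a)) * mpow f a * h z) = 0"
  shows "\<forall>k\<in>L. c k = 0"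
proof (rule ccontr)
  assume "\<not> (\<forall>k\<in>L. c k = 0)"
  define M where "M = {k \<in> L. c k \<noteq> 0}"
  have M: "finite M" "M \<noteq> {}" "M \<subseteq> Z \<times> UNIV"
    using \<open>\<not> (\<forall>k\<in>L. c k = 0)\<close> L by (auto simp: M_def)
  obtain w where w: "inj_on (\<lambda>a. \<Sum>i\<in>UNIV. lookup a i * w i) (snd ` M)"
    using injective_weight_exists[of "snd ` M"] M by auto
  define wt where "wt = (\<lambda>a :: 'v \<Rightarrow>\<^sub>0 nat. \<Sum>i\<in>UNIV. lookup a i * w i)"
  obtain k0 where k0: "is_arg_min (\<lambda>k. mdeg (snd k)) (\<lambda>k. k \<in> M) k0"
    using ex_is_arg_min_if_finite[OF M(1,2)] by blast
  \<comment> \<open>Exponents of least degree at the same point as \<open>k0\<close>. Among them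
    \<alpha> has the largest weight, so the others have strictly smaller weight.\<close>
  define P where "P = {a. (fst k0, a) \<in> M \<and> mdeg a = mdeg (snd k0)}"
  have "finite P"
    by (rule finite_subset[OF _ finite_imageI[OF M(1), of snd]]) (force simp: P_def)
  moreover have "snd k0 \<in> P" using k0 by (simp add: P_def is_arg_min_def)
  ultimately have "Max (wt ` P) \<in> wt ` P" and max: "\<And>a. a \<in> P \<Longrightarrow> wt a \<le> Max (wt ` P)"
    by (auto intro: Max_in)
  then obtain \<alpha> where \<alpha>: "\<alpha> \<in> P" "\<And>a. a \<in> P \<Longrightarrow> wt a \<le> wt \<alpha>"
    by (metis imageE)
  define z where "z = fst k0"
  have z: "(z, \<alpha>) \<in> M" "z \<in> Z" "\<And>k. k \<in> M \<Longrightarrow> mdeg \<alpha> \<le> mdeg (snd k)"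
    using \<alpha>(1) k0 M(3) by (auto simp: z_def P_def is_arg_min_def not_less)
  define F where "F = (\<lambda>i. translate z (f i))"
  define H where "H = (\<lambda>x. translate z (h x))"
  have c: "c (z, \<alpha>) \<noteq> 0" using z(1) by (simp add: M_def)
  \<comment> \<open>The relation solved for \<open>F\<^sup>\<alpha>\<close>. As \<open>H z\<close>
    is 1 at the origin, it is written as \<open>1 - (1 - H z)\<close>, and the defect
    \<open>1 - H z\<close>, which vanishes there, stays on the right as the coefficient of
    \<open>F\<^sup>\<alpha>\<close> itself.\<close>
  define g where "g = (\<lambda>k. if k = (z, \<alpha>) then 1 - H z else - Const (c k / c (z, \<alpha>)) * H (fst k))"
  have eval_H: "mvpoly_eval (H x) 0 = (if x = z then 1 else 0)" if "x \<in> Z" for x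
    using h[OF that z(2)] by (simp add: H_def eval_translate)
  have "(\<Sum>k\<in>M. Const (c k) * mpow f (snd k) * h (fst k)) = (\<Sum>(z, a)\<in>L. Const (c (z, a)) * mpow f a * h z)"
    unfolding M_def using L(1) by (intro sum.mono_neutral_cong_left) auto
  then have "translate z (\<Sum>k\<in>M. Const (c k) * mpow f (snd k) * h (fst k)) = 0"
    by (simp add: rel translate_hom)
  then have "(\<Sum>k\<in>M. Const (c k) * mpow F (snd k) * H (fst k)) = 0"
    by (simp add: translate_hom F_def H_def)
  then have "0 = Const (1 / c (z, \<alpha>)) * (\<Sum>k\<in>M. Const (c k) * mpow F (snd k) * H (fst k))"
    by simp
  also have "\<dots> = (\<Sum>k\<in>M. Const (c k / c (z, \<alpha>)) * mpow F (snd k) * H (fst k))"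
    by (simp add: sum_distrib_left mult.assoc[symmetric] flip: Const_mult)
  also have "\<dots> = mpow F \<alpha> * H z + (\<Sum>k\<in>M - {(z, \<alpha>)}. Const (c k / c (z, \<alpha>)) * mpow F (snd k) * H (fst k))"
    using c by (subst sum.remove[OF M(1) z(1)]) simp
  also have "(\<Sum>k\<in>M - {(z, \<alpha>)}. Const (c k / c (z, \<alpha>)) * mpow F (snd k) * H (fst k))
      = - (\<Sum>k\<in>M - {(z, \<alpha>)}. g k * mpow F (snd k))"
    unfolding sum_negf[symmetric] by (rule sum.cong) (auto simp: g_def mult_ac)
  finally have "mpow F \<alpha> * H z = (\<Sum>k\<in>M - {(z, \<alpha>)}. g k * mpow F (snd k))" by simp
  then have "mpow F \<alpha> = (\<Sum>k\<in>M. g k * mpow F (snd k))"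
    by (subst sum.remove[OF M(1) z(1)]) (simp add: g_def algebra_simps)
  moreover have "mpow F \<alpha> \<noteq> (\<Sum>k\<in>M. g k * mpow F (snd k))"
  proof (rule no_relation_at_isolated_zero[where wt = wt])
    show "F i \<in> hideg 1" for i
      using z(2) Z by (auto simp: F_def hideg_1_iff eval_translate simp del: One_nat_def)
    show "\<exists>k u. mvpoly_eval u 0 \<noteq> 0 \<and> Var j ^ k * u \<in> idl F" for j
      unfolding F_def by (rule zero_is_isolated[OF fin])
    show "wt (a + b) = wt a + wt b" for a b
      by (simp add: wt_def lookup_add distrib_right sum.distrib)
  next
    fix k assume k: "k \<in> M"
    have "g k \<in> hideg 1 \<or> wt (snd k) < wt \<alpha>" if deg: "mdeg (snd k) = mdeg \<alpha>"
    proof (cases "fst k = z \<and> k \<noteq> (z, \<alpha>)")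
      case True
      then have "snd k \<noteq> \<alpha>" by (cases k) auto
      moreover have "snd k \<in> P"
        using True k deg \<alpha>(1) by (cases k) (auto simp: P_def z_def)
      then have "wt (snd k) \<le> wt \<alpha>" by (rule \<alpha>(2))
      moreover have "wt (snd k) \<noteq> wt \<alpha>"
        using inj_onD[OF w, of "snd k" \<alpha>] \<open>snd k \<noteq> \<alpha>\<close> k z(1) by (force simp: wt_def)
      ultimately show ?thesis by simp
    next
      case False
      have "fst k \<in> Z" using k M(3) by auto
      then have "mvpoly_eval (g k) 0 = 0"
        using False z(2) by (auto simp: g_def eval_H)
      then show ?thesis by (simp add: hideg_1_iff del: One_nat_def)
    qed
    then show "mdeg \<alpha> < mdeg (snd k) \<or> mdeg (snd k) = mdeg \<alpha> \<and> (g k \<in> hideg 1 \<or> wt (snd k) < wt \<alpha>)"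
      using z(3)[OF k] by auto
  qed
  ultimately show False by blast
qed

section \<open>Affine Bezout inequality\<close>

text \<open>Supplies the contradiction between the exponential and the polynomial bound on the
  number of monomials. Taking the \<open>N + 1\<close>-st root of \<open>D / (D + 1)\<close> reduces
  the claim to the limit of \<open>k * s ^ k\<close>; the index \<open>N + 1\<close> keeps the root
  meaningful for \<open>N = 0\<close>.\<close>

lemma exponential_beats_power:
  fixes D H N :: nat
  shows "\<exists>k. D * (k * H + 1) ^ N * D ^ k < (D + 1) ^ k"
proof (cases "D = 0")
  case True
  then show ?thesis by (intro exI[of _ 1]) simp
next
  case False
  define r where "r = real D / (real D + 1)"
  have r: "0 < r" "r < 1" using False by (auto simp: r_def)
  define s where "s = root (Suc N) r"
  have s: "s ^ Suc N = r" "0 < s" "s < 1"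
    using r by (simp_all add: s_def del: power_Suc)
  have "(\<lambda>k. real k * s ^ k) \<longlonglongrightarrow> 0"
    using s by (intro powser_times_n_limit_0) simp
  moreover have "(\<lambda>k. s ^ k) \<longlonglongrightarrow> 0"
    using s by (intro LIMSEQ_power_zero) simp
  ultimately have "(\<lambda>k. real D * (real H * (real k * s ^ k) + s ^ k) ^ Suc N)
      \<longlonglongrightarrow> real D * (real H * 0 + 0) ^ Suc N"
    by (intro tendsto_mult tendsto_add tendsto_power tendsto_const)
  then have "\<forall>\<^sub>F k in sequentially. real D * (real H * (real k * s ^ k) + s ^ k) ^ Suc N < 1"
    by (rule order_tendstoD) simp
  then obtain k where "real D * (real H * (real k * s ^ k) + s ^ k) ^ Suc N < 1"
    by (meson eventually_at_top_linorder order_refl)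
  moreover have "real H * (real k * s ^ k) + s ^ k = (real k * real H + 1) * s ^ k"
    by (simp add: algebra_simps)
  moreover have "((real k * real H + 1) * s ^ k) ^ Suc N = (real k * real H + 1) ^ Suc N * r ^ k"
    by (metis power_mult_distrib power_mult mult.commute s(1))
  ultimately have "real D * ((real k * real H + 1) ^ Suc N * r ^ k) < 1"
    by metis
  moreover have "real D * ((real k * real H + 1) ^ N * r ^ k) \<le> real D * ((real k * real H + 1) ^ Suc N * r ^ k)"
    using r by (intro mult_left_mono mult_right_mono power_increasing) auto
  ultimately have "real D * (real k * real H + 1) ^ N * r ^ k < 1"
    by (simp only: mult.assoc)
  then have "real D * (real k * real H + 1) ^ N * real D ^ k < (real D + 1) ^ k"
    by (simp add: r_def power_divide divide_simps split: if_splits)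
  then have "real (D * (k * H + 1) ^ N * D ^ k) < real ((D + 1) ^ k)"
    by (simp add: add.commute)
  then show ?thesis by (meson of_nat_less_iff)
qed

text \<open>
  If \<open>Z\<close> has \<open>r > D = \<Prod> d\<^sub>i\<close> elements, the products \<open>f\<^sup>a h\<^sub>z\<close> with \<open>\<Sum> a\<^sub>i d\<^sub>i \<le> M\<close> are too many to be
  independent: rounding the exponents down to multiples of \<open>d\<^sub>i\<close> shows that they number at least
  \<open>r / D\<close> times the number of monomials of degree at most \<open>M\<close>.
\<close>

theorem affine_Bezout:
  fixes f :: "'v::finite \<Rightarrow> ('v, complex) mvpoly"
  assumes deg: "\<And>i. f i \<in> lowdeg (d i)" and d: "\<And>i. d i > 0"
    and fin: "finite {z. \<forall>i. mvpoly_eval (f i) z = 0}"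
  shows "card {z. \<forall>i. mvpoly_eval (f i) z = 0} \<le> (\<Prod>i\<in>UNIV. d i)"
proof (rule ccontr)
  define Z where "Z = {z. \<forall>i. mvpoly_eval (f i) z = 0}"
  define D where "D = (\<Prod>i\<in>UNIV. d i)"
  assume "\<not> card {z. \<forall>i. mvpoly_eval (f i) z = 0} \<le> (\<Prod>i\<in>UNIV. d i)"
  then have card_Z: "D + 1 \<le> card Z" by (simp add: Z_def D_def)
  have "finite Z" using fin by (simp add: Z_def)
  obtain h where h: "\<And>z. mvpoly_eval (h z) z = 1" "\<And>z w. w \<in> Z - {z} \<Longrightarrow> mvpoly_eval (h z) w = 0"
    using interpolating_polynomial_exists[OF \<open>finite Z\<close>] by metis
  have "\<exists>dh. \<forall>z. h z \<in> lowdeg (dh z)"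
    by (intro choice allI lowdeg_exists)
  then obtain dh where dh: "\<And>z. h z \<in> lowdeg (dh z)" by blast
  \<comment> \<open>A common degree bound for all \<open>h z\<close>. Multiplication by them thus
    enlarges degrees by a constant independent of \<open>M\<close>.\<close>
  define H where "H = (\<Sum>z\<in>Z. dh z)"
  have H: "h z \<in> lowdeg H" if "z \<in> Z" for z
    using lowdeg_mono[OF dh] \<open>finite Z\<close> that by (auto simp: H_def intro: member_le_sum)
  define S where "S = (\<lambda>M. {e :: 'v \<Rightarrow>\<^sub>0 nat. mdeg e \<le> M})"
  define A where "A = (\<lambda>M. {a :: 'v \<Rightarrow>\<^sub>0 nat. (\<Sum>i\<in>UNIV. lookup a i * d i) \<le> M})"
  have fin_S: "finite (S M)" for M by (simp add: S_def finite_mdeg_le)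
  have "mdeg a \<le> (\<Sum>i\<in>UNIV. lookup a i * d i)" for a :: "'v \<Rightarrow>\<^sub>0 nat"
    unfolding mdeg_def using d by (intro sum_mono) (simp add: Suc_leI)
  then have "A M \<subseteq> S M" for M
    by (auto simp: A_def S_def intro: order_trans)
  then have fin_A: "finite (A M)" for M using fin_S finite_subset by blast
  have S_le_A: "card (S M) \<le> D * card (A M)" for M
  proof -
    define B where "B = {e :: 'v \<Rightarrow>\<^sub>0 nat. \<forall>i. lookup e i \<in> {..<d i}}"
    \<comment> \<open>Reassembles an exponent vector from its quotients and remainders modulo the
      \<open>d i\<close>; there are \<open>D\<close> possible remainder vectors.\<close>
    define \<phi> where "\<phi> = (\<lambda>(a :: 'v \<Rightarrow>\<^sub>0 nat, b :: 'v \<Rightarrow>\<^sub>0 nat).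
        Abs_poly_mapping (\<lambda>i. lookup a i * d i + lookup b i))"
    have B: "finite B" "card B = D"
      unfolding B_def D_def by (subst exponent_box; simp)+
    have "S M \<subseteq> \<phi> ` (A M \<times> B)"
    proof
      fix e assume e: "e \<in> S M"
      define a where "a = Abs_poly_mapping (\<lambda>i. lookup e i div d i)"
      define b where "b = Abs_poly_mapping (\<lambda>i. lookup e i mod d i)"
      have ab: "lookup a i = lookup e i div d i" "lookup b i = lookup e i mod d i" for i
        by (simp_all add: a_def b_def)
      have "(\<Sum>i\<in>UNIV. lookup a i * d i) \<le> mdeg e"
        unfolding mdeg_def ab by (intro sum_mono) (simp add: div_times_less_eq_dividend)
      then have "a \<in> A M" using e by (simp add: A_def S_def)
      moreover have "b \<in> B" using d by (simp add: B_def ab)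
      moreover have "e = \<phi> (a, b)"
        by (rule poly_mapping_eqI) (simp add: \<phi>_def ab)
      ultimately show "e \<in> \<phi> ` (A M \<times> B)" by blast
    qed
    then have "card (S M) \<le> card (\<phi> ` (A M \<times> B))"
      using fin_A B by (intro card_mono) auto
    also have "\<dots> \<le> card (A M \<times> B)" using fin_A B by (intro card_image_le) auto
    finally show ?thesis by (simp add: card_cartesian_product B mult.commute)
  qed
  have indep: "card (Z \<times> A M) \<le> card (S (M + H))" for M
  proof (rule ccontr)
    assume "\<not> card (Z \<times> A M) \<le> card (S (M + H))"
    then have less: "card (S (M + H)) < card (Z \<times> A M)" by simp
    obtain l where l: "\<exists>k\<in>Z \<times> A M. l k \<noteq> 0"
      and eq: "\<forall>e\<in>S (M + H). (\<Sum>k\<in>Z \<times> A M. lookup (mpow f (snd k) * h (fst k)) e * l k) = 0"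
      using underdetermined_system[OF fin_S _ less, of "\<lambda>e k. lookup (mpow f (snd k) * h (fst k)) e"]
        \<open>finite Z\<close> fin_A by blast
    have "(\<Sum>k\<in>Z \<times> A M. Const (l k) * mpow f (snd k) * h (fst k)) = 0"
    proof (rule poly_mapping_eqI)
      fix e
      have "lookup (mpow f (snd k) * h (fst k)) e = 0" if "e \<notin> S (M + H)" "k \<in> Z \<times> A M" for k
      proof -
        have "mpow f (snd k) \<in> lowdeg M"
          using that(2) by (intro lowdeg_mono[OF lowdeg_mpow[OF deg]]) (auto simp: A_def)
        then have "mpow f (snd k) * h (fst k) \<in> lowdeg (M + H)"
          using H that(2) by (intro lowdeg_mult) auto
        then show ?thesis using that(1) by (force simp: lowdeg_def S_def in_keys_iff)
      qed
      then have "(\<Sum>k\<in>Z \<times> A M. lookup (mpow f (snd k) * h (fst k)) e * l k) = 0"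
        using eq by (cases "e \<in> S (M + H)") auto
      then show "lookup (\<Sum>k\<in>Z \<times> A M. Const (l k) * mpow f (snd k) * h (fst k)) e = lookup 0 e"
        unfolding lookup_sum mult.assoc lookup_Const_mult by (simp add: mult.commute)
    qed
    then have "(\<Sum>(z, a)\<in>Z \<times> A M. Const (l (z, a)) * mpow f a * h z) = 0"
      by (simp add: case_prod_unfold)
    moreover have "mvpoly_eval (h z) w = (if z = w then 1 else 0)" if "z \<in> Z" "w \<in> Z" for z w
      using h that by auto
    ultimately have "\<forall>k\<in>Z \<times> A M. l k = 0"
      using \<open>finite Z\<close> fin_A
      by (intro interpolating_family_independent[OF fin, of Z h]) (auto simp: Z_def)
    with l show False by blast
  qed
  have "(D + 1) * card (S M) \<le> D * card (S (M + H))" for M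
  proof -
    have "(D + 1) * card (S M) \<le> card Z * (D * card (A M))"
      by (intro mult_mono card_Z S_le_A) auto
    also have "\<dots> = D * card (Z \<times> A M)" by (simp add: card_cartesian_product)
    also have "\<dots> \<le> D * card (S (M + H))" by (intro mult_left_mono indep) auto
    finally show ?thesis .
  qed
  \<comment> \<open>Each increase of the degree bound by \<open>H\<close> multiplies the number of
    monomials by at least \<open>(D + 1) / D\<close>, which would be exponential growth.\<close>
  then have growth: "(D + 1) ^ k \<le> D ^ k * card (S (k * H))" for k
  proof (induction k)
    case 0
    have "S 0 = {0}" by (auto simp: S_def mdeg_def intro!: poly_mapping_eqI)
    then show ?case by simp
  next
    case (Suc k)
    have "(D + 1) ^ Suc k \<le> (D + 1) * (D ^ k * card (S (k * H)))"
      using Suc by (simp only: power_Suc mult_le_mono)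
    also have "\<dots> = D ^ k * ((D + 1) * card (S (k * H)))" by (simp only: mult_ac)
    also have "\<dots> \<le> D ^ k * (D * card (S (k * H + H)))" by (intro mult_left_mono Suc.prems) simp
    finally show ?case by (simp add: mult_ac add.commute)
  qed
  obtain k where k: "D * (k * H + 1) ^ CARD('v) * D ^ k < (D + 1) ^ k"
    using exponential_beats_power by blast
  have "D > 0" using d by (simp add: D_def)
  note growth[of k]
  also have "D ^ k * card (S (k * H)) \<le> D ^ k * (k * H + 1) ^ CARD('v)"
    unfolding S_def by (intro mult_left_mono card_mdeg_le) simp
  also have "\<dots> \<le> D * (k * H + 1) ^ CARD('v) * D ^ k" using \<open>D > 0\<close> by simp
  finally show False using k by simp
qed

section \<open>Real zeros on the sphere as complex zeros\<close>

lemma keys_complexify [simp]: "keys (complexify p) = keys p"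
  by (auto simp: complexify_def in_keys_iff Poly_Mapping.map.rep_eq when_def)

lemma lookup_complexify: "lookup (complexify p) e = complex_of_real (lookup p e)"
  by (simp add: complexify_def Poly_Mapping.map.rep_eq when_def)

lemma mvpoly_eval_complexify:
  "mvpoly_eval (complexify p) (\<chi> i. complex_of_real (x $ i)) = complex_of_real (mvpoly_eval p x)"
  by (simp add: mvpoly_eval_def lookup_complexify)

lemma mvpoly_eval_const:
  assumes "p \<noteq> 0" "homogeneous 0 p"
  shows "mvpoly_eval p x \<noteq> (0::'a::comm_semiring_1)"
proof -
  have "e = 0" if "e \<in> keys p" for e
    using assms(2) that by (auto simp: homogeneous_def intro!: poly_mapping_eqI)
  moreover have "keys p \<noteq> {}"
    using assms(1) sum_single_keys[of p] by auto
  ultimately have "keys p = {0}" by blast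
  then have "mvpoly_eval p x = lookup p 0" "lookup p 0 \<noteq> 0"
    by (simp_all add: mvpoly_eval_def flip: in_keys_iff)
  then show ?thesis by simp
qed

theorem theorem4p1:
  fixes n :: nat
    and m :: "nat \<Rightarrow> nat"
    and p :: "nat \<Rightarrow> ('v::finite, real) mvpoly"
    and u :: "nat \<Rightarrow> real ^ 'v \<Rightarrow> real"
  assumes "CARD('v) = n + 1"
    and "\<And>i. i \<in> {1..n} \<Longrightarrow> p i \<noteq> 0"
    and "\<And>i. i \<in> {1..n} \<Longrightarrow> homogeneous (m i) (p i)"
    and "\<And>i. i \<in> {1..n} \<Longrightarrow> harmonic (p i)"
    and "\<And>i. i \<in> {1..n} \<Longrightarrow> u i = sphere_restriction (p i)"
    and "generic_system {1..n} p"
  shows "finite (common_zeros {1..n} u) \<and> card (common_zeros {1..n} u) \<le> 2 * (\<Prod>i=1..n. m i)"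
proof -
  define C where "C = {z \<in> complex_sphere. \<forall>i\<in>{1..n}. mvpoly_eval (complexify (p i)) z = 0}"
  define \<iota> where "\<iota> = (\<lambda>x :: real ^ 'v. \<chi> i. complex_of_real (x $ i))"
  have "finite C" using assms(6) by (simp add: generic_system_def C_def)
  have zeros: "common_zeros {1..n} u = {x \<in> sphere 0 1. \<forall>i\<in>{1..n}. mvpoly_eval (p i) x = 0}"
    using assms(5) by (auto simp: common_zeros_def sphere_restriction_def)
  have "inj \<iota>" by (auto simp: \<iota>_def inj_on_def vec_eq_iff)
  have sub: "\<iota> ` common_zeros {1..n} u \<subseteq> C"
  proof (rule image_subsetI)
    fix x assume x: "x \<in> common_zeros {1..n} u"
    then have "x \<bullet> x = 1" unfolding zeros by (simp add: norm_eq_1)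
    then have "(\<Sum>i\<in>UNIV. (x $ i)\<^sup>2) = 1"
      by (simp add: inner_vec_def power2_eq_square)
    then have "complex_of_real (\<Sum>i\<in>UNIV. (x $ i)\<^sup>2) = 1" by simp
    then have "\<iota> x \<in> complex_sphere"
      by (simp add: complex_sphere_def \<iota>_def)
    with x show "\<iota> x \<in> C"
      unfolding C_def zeros by (simp add: \<iota>_def mvpoly_eval_complexify)
  qed
  have fin: "finite (common_zeros {1..n} u)"
    using finite_subset[OF sub \<open>finite C\<close>] \<open>inj \<iota>\<close> by (meson finite_imageD inj_on_subset subset_UNIV)
  moreover have "card (common_zeros {1..n} u) \<le> 2 * (\<Prod>i=1..n. m i)"
  \<comment> \<open>The Bezout inequality asks for positive degree bounds. In degree 0 a nonzero
    polynomial is constant, so there are no common zeros.\<close>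
  proof (cases "\<exists>i\<in>{1..n}. m i = 0")
    case True
    then obtain i where i: "i \<in> {1..n}" "m i = 0" by blast
    then have "mvpoly_eval (p i) x \<noteq> 0" for x
      using mvpoly_eval_const[of "p i" x] assms(2,3)[OF i(1)] by simp
    with i(1) have "common_zeros {1..n} u = {}" unfolding zeros by blast
    then show ?thesis by simp
  next
    case False
    \<comment> \<open>The Bezout inequality indexes equations by the variables themselves, so the
      \<open>n + 1\<close> equations are transported to the type \<open>'v\<close>.\<close>
    obtain \<sigma> where \<sigma>: "bij_betw \<sigma> (UNIV :: 'v set) {..n}"
      using finite_same_card_bij[of "UNIV :: 'v set" "{..n}"] assms(1) by auto
    \<comment> \<open>The given polynomials are numbered from 1, so index 0 is free for the equation
      of the sphere. Its degree is the factor 2 in the bound.\<close>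
    define q where "q = (\<lambda>i. if i = 0 then (\<Sum>j\<in>UNIV. Var j ^ 2) - 1 else complexify (p i))"
    define d where "d = (\<lambda>i. if i = 0 then 2 else m i)"
    have "(Var j :: ('v, complex) mvpoly) ^ 2 \<in> lowdeg 2" for j
      using lowdeg_power[of "Var j" 1 2] by (auto simp: lowdeg_def Var_def)
    then have "q 0 \<in> lowdeg 2"
      using keys_diff[of "\<Sum>j\<in>UNIV. (Var j :: ('v, complex) mvpoly) ^ 2" 1]
        keys_sum_subset[of "\<lambda>j. (Var j :: ('v, complex) mvpoly) ^ 2" UNIV]
      unfolding q_def lowdeg_def by fastforce
    then have deg: "q i \<in> lowdeg (d i)" if "i \<le> n" for i
      using that assms(3)[of i] by (auto simp: d_def q_def lowdeg_def homogeneous_def mdeg_def)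
    have range: "range \<sigma> = {..n}" using \<sigma> by (simp add: bij_betw_def)
    have "(\<forall>j. mvpoly_eval (q (\<sigma> j)) z = 0) \<longleftrightarrow> (\<forall>i\<in>{..n}. mvpoly_eval (q i) z = 0)" for z
      unfolding range[symmetric] by blast
    moreover have "{..n} = insert 0 {1..n}" by auto
    ultimately have C: "{z. \<forall>j. mvpoly_eval (q (\<sigma> j)) z = 0} = C"
      by (auto simp: C_def q_def complex_sphere_def)
    have "card C \<le> (\<Prod>j\<in>UNIV. d (\<sigma> j))"
      unfolding C[symmetric]
    proof (rule affine_Bezout)
      fix j
      have "\<sigma> j \<le> n" using range by auto
      then show "q (\<sigma> j) \<in> lowdeg (d (\<sigma> j))" "d (\<sigma> j) > 0"
        using False deg by (auto simp: d_def)
    qed (simp add: C \<open>finite C\<close>)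
    also have "\<dots> = (\<Prod>i\<in>{..n}. d i)" by (rule prod.reindex_bij_betw[OF \<sigma>])
    also have "\<dots> = 2 * (\<Prod>i=1..n. m i)"
      unfolding \<open>{..n} = insert 0 {1..n}\<close> by (simp add: d_def)
    finally have "card C \<le> 2 * (\<Prod>i=1..n. m i)" .
    moreover have "card (common_zeros {1..n} u) \<le> card C"
      using \<open>inj \<iota>\<close> sub \<open>finite C\<close> by (meson card_inj_on_le inj_on_subset subset_UNIV)
    ultimately show ?thesis by simp
  qed
  ultimately show ?thesis by blast
qed

end
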